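(* Let $G$ be a topological group whose topology is induced by a left-invariant metric $d$ (i.e. $d(gx,gy)=d(x,y)$ for all $g,x,y\in G$), and assume that $G$ is reflexively representable. Then there is a left-invariant stable metric $\delta$ on $G$ that is uniformly equivalent to $d$.
   Context: Let $e$ denote the identity of $G$. A metric $\rho$ on $G$ is called stable if for all sequences $(s_n)_{n\in\mathbb N}$, $(t_m)_{m\in\mathbb N}$ in $G$ which are bounded (i.e. there is $M$ with $\rho(e,s_n)\le M$ and $\rho(e,t_m)\le M$ for all $n,m$) and for all ultrafilters $\mathcal U,\mathcal V$ on $\mathbb N$ we have $\lim_{n,\mathcal U}\lim_{m,\mathcal V}\rho(s_n,t_m)=\lim_{m,\mathcal V}\lim_{n,\mathcal U}\rho(s_n,t_m)$. Two metrics $\rho_1,\rho_2$ on $G$ are uniformly equivalent if for every $\varepsilon>0$ there is $\eta>0$ such that $\rho_i(x,y)<\eta$ implies $\rho_j(x,y)<\varepsilon$ for $i,j\in\{1,2\}$. A topological group $G$ is reflexively representable if there exist a reflexive Banach space $E$ and a group homomorphism from $G$ into the group of surjective linear isometries of $E$ which is a topological isomorphism onto its image, where the isometry group carries the strong operator topology (the weakest topology making the maps $T\mapsto Tv$, $v\in E$, continuous); equivalently, with the weak operator topology. *)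

theory Defs
  imports "HOL-Analysis.Analysis" "HOL-Algebra.Group"
begin

section \<open>Topological groups and metrics on groups\<close>

definition topological_group :: "('a, 'b) monoid_scheme \<Rightarrow> 'a topology \<Rightarrow> bool" where
  "topological_group G X \<longleftrightarrow>
     group G \<and> topspace X = carrier G \<and>
     continuous_map (prod_topology X X) X (\<lambda>(x, y). x \<otimes>\<^bsub>G\<^esub> y) \<and>
     continuous_map X X (\<lambda>x. inv\<^bsub>G\<^esub> x)"

definition left_invariant :: "('a, 'b) monoid_scheme \<Rightarrow> ('a \<Rightarrow> 'a \<Rightarrow> real) \<Rightarrow> bool" where
  "left_invariant G d \<longleftrightarrow>
     (\<forall>g\<in>carrier G. \<forall>x\<in>carrier G. \<forall>y\<in>carrier G. d (g \<otimes>\<^bsub>G\<^esub> x) (g \<otimes>\<^bsub>G\<^esub> y) = d x y)"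

definition uniformly_equivalent ::
    "'a set \<Rightarrow> ('a \<Rightarrow> 'a \<Rightarrow> real) \<Rightarrow> ('a \<Rightarrow> 'a \<Rightarrow> real) \<Rightarrow> bool" where
  "uniformly_equivalent S d1 d2 \<longleftrightarrow>
     (\<forall>\<epsilon>>0. \<exists>\<eta>>0. \<forall>x\<in>S. \<forall>y\<in>S.
        (d1 x y < \<eta> \<longrightarrow> d2 x y < \<epsilon>) \<and> (d2 x y < \<eta> \<longrightarrow> d1 x y < \<epsilon>))"


section \<open>Stability\<close>

text \<open>Principal ultrafilters are included.\<close>

definition ultrafilter :: "'i filter \<Rightarrow> bool" where
  "ultrafilter U \<longleftrightarrow>
     U \<noteq> bot \<and> (\<forall>P. eventually P U \<or> eventually (\<lambda>i. \<not> P i) U)"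

text \<open>
  \<^const>\<open>Lim\<close> is a definite description. The limits in the definition of stability below are
  taken of bounded functions along ultrafilters, so they exist by the following lemma.
\<close>

lemma ultrafilter_tendsto_Lim:
  fixes f :: "'i \<Rightarrow> real"
  assumes U: "ultrafilter U" and bd: "\<And>i. \<bar>f i\<bar> \<le> B"
  shows "(f \<longlongrightarrow> Lim U f) U" and "\<bar>Lim U f\<bar> \<le> B"
proof -
  have nb: "U \<noteq> bot" using U by (simp add: ultrafilter_def)
  have "filtermap f U \<noteq> bot" using nb by (simp add: filtermap_bot_iff)
  moreover have "eventually (\<lambda>x. x \<in> {-B..B}) (filtermap f U)"
    using bd by (simp add: eventually_filtermap abs_le_iff minus_le_iff)
  ultimately obtain l where l: "inf (nhds l) (filtermap f U) \<noteq> bot"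
    using compact_Icc[of "-B" B] unfolding compact_filter by blast
  have lim: "(f \<longlongrightarrow> l) U"
  proof (rule topological_tendstoI)
    fix S assume S: "open S" "l \<in> S"
    show "eventually (\<lambda>i. f i \<in> S) U"
    proof (rule ccontr)
      assume "\<not> eventually (\<lambda>i. f i \<in> S) U"
      then have "eventually (\<lambda>i. f i \<notin> S) U"
        using U unfolding ultrafilter_def by blast
      then have "eventually (\<lambda>x. x \<notin> S) (filtermap f U)"
        by (simp add: eventually_filtermap)
      moreover have "eventually (\<lambda>x. x \<in> S) (nhds l)"
        using S by (rule eventually_nhds_in_open)
      ultimately have "eventually (\<lambda>x. False) (inf (nhds l) (filtermap f U))"
        unfolding eventually_inf by blast
      with l show False by (simp add: trivial_limit_def)
    qed
  qed
  then have eq: "Lim U f = l" using nb by (intro tendsto_Lim)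
  show "(f \<longlongrightarrow> Lim U f) U" using lim eq by simp
  have "((\<lambda>i. \<bar>f i\<bar>) \<longlongrightarrow> \<bar>l\<bar>) U" using lim by (rule tendsto_rabs)
  then show "\<bar>Lim U f\<bar> \<le> B"
    unfolding eq by (rule tendsto_upperbound) (use bd nb in auto)
qed

definition stable_metric :: "('a, 'b) monoid_scheme \<Rightarrow> ('a \<Rightarrow> 'a \<Rightarrow> real) \<Rightarrow> bool" where
  "stable_metric G \<rho> \<longleftrightarrow>
     (\<forall>(s :: nat \<Rightarrow> 'a) (t :: nat \<Rightarrow> 'a).
        range s \<subseteq> carrier G \<and> range t \<subseteq> carrier G \<and>
        (\<exists>M. \<forall>n m. \<rho> \<one>\<^bsub>G\<^esub> (s n) \<le> M \<and> \<rho> \<one>\<^bsub>G\<^esub> (t m) \<le> M) \<longrightarrow>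
        (\<forall>U V :: nat filter. ultrafilter U \<and> ultrafilter V \<longrightarrow>
           Lim U (\<lambda>n. Lim V (\<lambda>m. \<rho> (s n) (t m))) =
           Lim V (\<lambda>m. Lim U (\<lambda>n. \<rho> (s n) (t m)))))"


section \<open>Reflexive representability\<close>

text \<open>
  Scalars are real. A complex Banach space is reflexive iff its underlying real Banach space is,
  and complex-linear isometries are real-linear, so complex representations are covered too.
\<close>

definition bidual_embedding :: "'e::real_normed_vector \<Rightarrow> ('e \<Rightarrow>\<^sub>L real) \<Rightarrow>\<^sub>L real" where
  "bidual_embedding = blinfun.prod_left"

lemma bidual_embedding_apply: "blinfun_apply (bidual_embedding x) f = blinfun_apply f x"
  by (simp add: bidual_embedding_def)

definition reflexive_space :: "'e::banach itself \<Rightarrow> bool" where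
  "reflexive_space _ \<longleftrightarrow> surj (bidual_embedding :: 'e \<Rightarrow> ('e \<Rightarrow>\<^sub>L real) \<Rightarrow>\<^sub>L real)"

definition isometry_group :: "('e::real_normed_vector \<Rightarrow>\<^sub>L 'e) monoid" where
  "isometry_group =
     \<lparr>carrier = {T. surj (blinfun_apply T) \<and> (\<forall>v. norm (blinfun_apply T v) = norm v)},
      mult = (o\<^sub>L), one = id_blinfun\<rparr>"

lemma group_isometry_group: "group (isometry_group :: ('e::real_normed_vector \<Rightarrow>\<^sub>L 'e) monoid)"
proof (rule groupI)
  fix T :: "'e \<Rightarrow>\<^sub>L 'e" assume "T \<in> carrier isometry_group"
  then have s: "surj (blinfun_apply T)" and n: "\<And>v. norm (blinfun_apply T v) = norm v"
    by (auto simp: isometry_group_def)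
  have i: "inj (blinfun_apply T)"
  proof (rule injI)
    fix x y assume "blinfun_apply T x = blinfun_apply T y"
    then have "norm (x - y) = 0" using n[of "x - y"] by (simp add: blinfun.diff_right)
    then show "x = y" by simp
  qed
  let ?g = "inv_into UNIV (blinfun_apply T)"
  have Tg: "blinfun_apply T (?g v) = v" for v using s by (rule surj_f_inv_f)
  have gT: "?g (blinfun_apply T v) = v" for v using i by (rule inv_f_f)
  have ng: "norm (?g v) = norm v" for v using n[of "?g v"] Tg[of v] by simp
  have "bounded_linear ?g"
  proof (rule bounded_linear_intro[where K = 1])
    show "?g (x + y) = ?g x + ?g y" for x y
      by (rule injD[OF i]) (simp add: Tg blinfun.add_right)
    show "?g (r *\<^sub>R x) = r *\<^sub>R ?g x" for r x
      by (rule injD[OF i]) (simp add: Tg blinfun.scaleR_right)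
  qed (simp add: ng)
  then have app: "blinfun_apply (Blinfun ?g) = ?g" by (rule bounded_linear_Blinfun_apply)
  have "surj ?g" using gT by (metis surjI)
  then show "\<exists>S\<in>carrier isometry_group. S \<otimes>\<^bsub>isometry_group\<^esub> T = \<one>\<^bsub>isometry_group\<^esub>"
    by (intro bexI[of _ "Blinfun ?g"])
       (auto simp: isometry_group_def app ng gT intro!: blinfun_eqI)
next
  fix S T :: "'e \<Rightarrow>\<^sub>L 'e"
  assume "S \<in> carrier isometry_group" "T \<in> carrier isometry_group"
  moreover have "surj (blinfun_apply (S o\<^sub>L T))"
    if "surj (blinfun_apply S)" "surj (blinfun_apply T)"
    using comp_surj[OF that(2,1)] by (simp add: blinfun_compose.rep_eq)
  ultimately show "S \<otimes>\<^bsub>isometry_group\<^esub> T \<in> carrier isometry_group"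
    by (simp add: isometry_group_def)
qed (auto simp: isometry_group_def intro!: blinfun_eqI)

text \<open>
  Representability on the given Banach space \<^typ>\<open>'e\<close>. Being reflexively representable means that
  this holds for some type \<^typ>\<open>'e\<close>; as HOL cannot quantify over types inside a formula, this
  hypothesis is used with \<^typ>\<open>'e\<close> a free (hence universally quantified) type variable.
\<close>

definition reflexively_representable_on ::
    "'e::banach itself \<Rightarrow> ('a, 'b) monoid_scheme \<Rightarrow> 'a topology \<Rightarrow> bool" where
  "reflexively_representable_on E G X \<longleftrightarrow>
     reflexive_space E \<and>
     (\<exists>\<pi> \<in> hom G (isometry_group :: ('e \<Rightarrow>\<^sub>L 'e) monoid).
        homeomorphic_map X (subtopology strong_operator_topology (\<pi> ` carrier G)) \<pi>)"

end

theory Submission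
  imports Defs
begin

text \<open>
  A matrix coefficient \<open>g \<mapsto> \<phi> (\<pi> g v)\<close> of a reflexive representation is weakly almost periodic:
  its kernel \<open>(x, y) \<mapsto> \<phi> (\<pi> (x\<inverse> y) v)\<close> admits the exchange of ultrafilter limits, because bounded
  families in \<open>E\<close> and in its dual have weak limits. Bounded sets of a reflexive space have nonempty
  relatively weakly open subsets of arbitrarily small diameter, and since the group acts by
  isometries, this makes finitely many coefficients control \<open>\<parallel>\<pi> g v - v\<parallel>\<close>. Hence for each \<open>r\<close> there is a
  weakly almost periodic \<open>p\<close> with values in \<open>[0, 1]\<close>, zero near the identity and one outside the
  \<open>r\<close>-ball. Such functions \<open>p\<^sub>n\<close> are chosen for rapidly decreasing radii, \<open>r\<^sub>n\<close> being so small that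
  translations by elements of the \<open>r\<^sub>n\<close>-ball move every earlier \<open>p\<^sub>j\<close> by at most \<open>(2/3)^n / 3\<close>.
  Then \<open>\<delta> x y = (\<Sum>n. (2/3)^n * p\<^sub>n (x\<inverse> y))\<close> satisfies the triangle inequality exactly, and it
  inherits stability from the summands as a uniform limit.
\<close>

section \<open>The Hahn-Banach theorem and ultrafilters\<close>

definition sublinear :: "('a::real_vector \<Rightarrow> real) \<Rightarrow> bool" where
  "sublinear p \<longleftrightarrow> (\<forall>x y. p (x + y) \<le> p x + p y) \<and> (\<forall>c\<ge>0. \<forall>x. p (c *\<^sub>R x) = c * p x)"

lemma sublinear_add: "sublinear p \<Longrightarrow> p (x + y) \<le> p x + p y"
  and sublinear_scaleR: "sublinear p \<Longrightarrow> c \<ge> 0 \<Longrightarrow> p (c *\<^sub>R x) = c * p x"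
  by (auto simp: sublinear_def)

lemma sublinear_zero: "sublinear p \<Longrightarrow> p 0 = 0"
  using sublinear_scaleR[of p 0 0] by simp

lemma sublinear_minus: "sublinear p \<Longrightarrow> - p (- x) \<le> p x"
  using sublinear_add[of p x "-x"] sublinear_zero[of p] by simp

lemma sublinear_norm: "sublinear norm"
  by (simp add: sublinear_def norm_triangle_ineq)

text \<open>The one-sided scaling bound forces equality, because it can also be applied to
  \<open>c *\<^sub>R x\<close> with the factor \<open>1 / c\<close>.\<close>

lemma sublinearI:
  assumes "\<And>x y. p (x + y) \<le> p x + p y" and le: "\<And>c x. c > 0 \<Longrightarrow> p (c *\<^sub>R x) \<le> c * p x"
    and zero: "p 0 = 0"
  shows "sublinear p"
  unfolding sublinear_def
proof (intro conjI allI impI assms)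
  fix c :: real and x :: 'a assume "c \<ge> 0"
  show "p (c *\<^sub>R x) = c * p x"
  proof (cases "c = 0")
    case False
    then have c: "c > 0" using \<open>c \<ge> 0\<close> by simp
    have "p ((1 / c) *\<^sub>R (c *\<^sub>R x)) \<le> (1 / c) * p (c *\<^sub>R x)"
      by (rule le) (use c in simp)
    then have "c * p x \<le> p (c *\<^sub>R x)" using c by (simp add: field_simps)
    then show ?thesis using le[OF c, of x] by simp
  qed (simp add: zero)
qed

text \<open>Builds the side condition into the majorant instead of extending a functional from a
  subspace: a linear functional below \<open>q\<close> is automatically at least \<open>a\<close> on
  \<open>K\<close>.\<close>

lemma sublinear_cut:
  fixes p :: "'a::real_vector \<Rightarrow> real"
  assumes p: "sublinear p" and K: "convex K" "K \<noteq> {}" and a: "\<And>k. k \<in> K \<Longrightarrow> a \<le> p k"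
  obtains q where "sublinear q" "q \<le> p" "\<And>k. k \<in> K \<Longrightarrow> q (- k) \<le> - a"
proof -
  \<comment> \<open>The infimum of these values is the largest sublinear functional below
    \<open>p\<close> with the required bound at every \<open>- k\<close>.\<close>
  define S where "S z = (\<lambda>(t, k). p (z + t *\<^sub>R k) - t * a) ` ({0..} \<times> K)" for z
  define q where "q z = Inf (S z)" for z
  \<comment> \<open>This is where the bound \<open>a\<close> on \<open>K\<close> enters. It keeps
    the infimum finite, and at \<open>z = 0\<close> it yields \<open>q 0 \<ge> 0\<close>.\<close>
  have lb: "- p (- z) \<le> p (z + t *\<^sub>R k) - t * a" if "t \<ge> 0" "k \<in> K" for z t k
  proof -
    have "t * a \<le> p (t *\<^sub>R k)" using a[of k] that by (simp add: sublinear_scaleR[OF p] mult_left_mono)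
    also have "\<dots> \<le> p (z + t *\<^sub>R k) + p (- z)"
      using sublinear_add[OF p, of "z + t *\<^sub>R k" "- z"] by simp
    finally show ?thesis by simp
  qed
  have bdd: "bdd_below (S z)" for z
    unfolding S_def by (rule bdd_belowI[of _ "- p (- z)"]) (use lb in auto)
  have ne: "S z \<noteq> {}" for z using K by (auto simp: S_def)
  have le: "q z \<le> p (z + t *\<^sub>R k) - t * a" if "t \<ge> 0" "k \<in> K" for z t k
    unfolding q_def by (rule cInf_lower[OF _ bdd]) (use that in \<open>auto simp: S_def\<close>)
  have ge: "c \<le> q z" if "\<And>t k. t \<ge> 0 \<Longrightarrow> k \<in> K \<Longrightarrow> c \<le> p (z + t *\<^sub>R k) - t * a" for c z
    unfolding q_def by (rule cInf_greatest[OF ne]) (use that in \<open>auto simp: S_def\<close>)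
  obtain k0 where k0: "k0 \<in> K" using K by blast
  have qp: "q z \<le> p z" for z using le[OF _ k0, of 0] by simp
  have "sublinear q"
  proof (rule sublinearI)
    fix x y
    have "q (x + y) - (p (x + t *\<^sub>R k) - t * a) \<le> p (y + u *\<^sub>R l) - u * a"
      if t: "t \<ge> 0" "k \<in> K" "u \<ge> 0" "l \<in> K" for t k u l
    proof -
      \<comment> \<open>By convexity a candidate for \<open>x\<close> and a candidate for
        \<open>y\<close> combine into one for \<open>x + y\<close>, with parameter
        \<open>t + u\<close>.\<close>
      obtain m where m: "m \<in> K" "(t + u) *\<^sub>R m = t *\<^sub>R k + u *\<^sub>R l"
      proof (cases "t + u = 0")
        case True
        then have "t = 0" "u = 0" using t by auto
        then show ?thesis using that k0 by auto
      next
        case False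
        then have "t + u > 0" using t by simp
        have "(t / (t + u)) *\<^sub>R k + (u / (t + u)) *\<^sub>R l \<in> K"
          using t False by (intro convexD[OF K(1)]) (auto simp: add_divide_distrib[symmetric])
        moreover have "(t + u) *\<^sub>R ((t / (t + u)) *\<^sub>R k + (u / (t + u)) *\<^sub>R l) = t *\<^sub>R k + u *\<^sub>R l"
          using False by (simp add: scaleR_add_right)
        ultimately show ?thesis using that by blast
      qed
      have "q (x + y) \<le> p (x + y + (t + u) *\<^sub>R m) - (t + u) * a" using t m by (intro le) auto
      also have "x + y + (t + u) *\<^sub>R m = (x + t *\<^sub>R k) + (y + u *\<^sub>R l)" by (simp add: m)
      also have "p \<dots> \<le> p (x + t *\<^sub>R k) + p (y + u *\<^sub>R l)" by (rule sublinear_add[OF p])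
      finally show ?thesis by (simp add: algebra_simps)
    qed
    then have "q (x + y) - (p (x + t *\<^sub>R k) - t * a) \<le> q y" if "t \<ge> 0" "k \<in> K" for t k
      using that by (intro ge) auto
    then have "q (x + y) - q y \<le> q x" by (intro ge) (simp add: algebra_simps)
    then show "q (x + y) \<le> q x + q y" by simp
  next
    fix c :: real and x :: 'a assume c: "c > 0"
    have "q (c *\<^sub>R x) / c \<le> p (x + t *\<^sub>R k) - t * a" if "t \<ge> 0" "k \<in> K" for t k
    proof -
      have "q (c *\<^sub>R x) \<le> p (c *\<^sub>R x + (c * t) *\<^sub>R k) - (c * t) * a"
        using c that by (intro le) auto
      also have "c *\<^sub>R x + (c * t) *\<^sub>R k = c *\<^sub>R (x + t *\<^sub>R k)" by (simp add: scaleR_add_right)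
      also have "p \<dots> = c * p (x + t *\<^sub>R k)" using c by (simp add: sublinear_scaleR[OF p])
      finally show ?thesis using c by (simp add: field_simps)
    qed
    then have "q (c *\<^sub>R x) / c \<le> q x" by (rule ge)
    then show "q (c *\<^sub>R x) \<le> c * q x" using c by (simp add: field_simps)
  next
    show "q 0 = 0"
    proof (rule antisym)
      show "q 0 \<le> 0" using qp[of 0] sublinear_zero[OF p] by simp
      show "0 \<le> q 0" using lb[of _ _ 0] sublinear_zero[OF p] by (intro ge) simp
    qed
  qed
  moreover have "q (- k) \<le> - a" if "k \<in> K" for k
    using le[of 1 k "- k"] that sublinear_zero[OF p] by simp
  ultimately show ?thesis using that qp by (auto simp: le_fun_def)
qed

text \<open>Cutting \<open>q\<close> at the single point \<open>y\<close> with
  \<open>a = q y\<close> yields a functional below \<open>q\<close> whose value at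
  \<open>- y\<close> is at most \<open>- q y\<close>. Minimality identifies it with
  \<open>q\<close>, so \<open>q\<close> is odd, and an odd sublinear functional is additive.\<close>

lemma sublinear_minimal_linear:
  fixes q :: "'a::real_vector \<Rightarrow> real"
  assumes q: "sublinear q" and min: "\<And>r. sublinear r \<Longrightarrow> r \<le> q \<Longrightarrow> r = q"
  shows "linear q"
proof -
  have odd: "q (- y) = - q y" for y
  proof -
    obtain r where "sublinear r" "r \<le> q" "r (- y) \<le> - q y"
      using sublinear_cut[OF q convex_singleton, of y "q y"] by auto
    then have "q (- y) \<le> - q y" using min[of r] by simp
    then show ?thesis using sublinear_minus[OF q, of y] by simp
  qed
  show ?thesis
  proof (rule linearI)
    fix x y
    show "q (x + y) = q x + q y"
      using sublinear_add[OF q, of x y] sublinear_add[OF q, of "- x" "- y"] odd[of x] odd[of y]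
        odd[of "x + y"] by simp
  next
    fix c x
    show "q (c *\<^sub>R x) = c *\<^sub>R q x"
    proof (cases "c \<ge> 0")
      case False
      then have "q ((- c) *\<^sub>R x) = (- c) * q x" by (intro sublinear_scaleR[OF q]) auto
      then show ?thesis using odd[of "c *\<^sub>R x"] by simp
    qed (simp add: sublinear_scaleR[OF q])
  qed
qed

text \<open>Zorn's lemma gives a minimal sublinear functional below \<open>p\<close>, which is
  linear. Pointwise infima serve as lower bounds of chains.\<close>

theorem hahn_banach_sublinear:
  fixes p :: "'a::real_vector \<Rightarrow> real"
  assumes p: "sublinear p"
  obtains f where "linear f" "f \<le> p"
proof -
  define A where "A = {q. sublinear q \<and> q \<le> p}"
  have "\<exists>m\<in>A. \<forall>a\<in>A. a \<le> m \<longrightarrow> a = m"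
  proof (rule predicate_Zorn)
    show "partial_order_on A (relation_of (\<lambda>f g. g \<le> f) A)"
      by (rule partial_order_on_relation_ofI) auto
  next
    fix C assume C: "C \<in> Chains (relation_of (\<lambda>f g. g \<le> f) A)"
    have CA: "C \<subseteq> A" using C by (auto simp: Chains_def relation_of_def)
    have tot: "f \<le> g \<or> g \<le> f" if "f \<in> C" "g \<in> C" for f g
      using C that by (auto simp: Chains_def relation_of_def)
    show "\<exists>u\<in>A. \<forall>a\<in>C. u \<le> a"
    proof (cases "C = {}")
      case True
      then show ?thesis using p by (auto simp: A_def)
    next
      case False
      define u where "u x = (INF f\<in>C. f x)" for x
      have bdd: "bdd_below ((\<lambda>f. f x) ` C)" for x
      proof (rule bdd_belowI[of _ "- p (- x)"])
        fix b assume "b \<in> (\<lambda>f. f x) ` C"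
        then obtain f where f: "f \<in> A" "b = f x" using CA by auto
        then have "f (- x) \<le> p (- x)" "sublinear f" by (auto simp: A_def le_fun_def)
        then show "- p (- x) \<le> b" using sublinear_minus[of f x] f by simp
      qed
      have le: "u x \<le> f x" if "f \<in> C" for f x
        unfolding u_def by (rule cINF_lower[OF bdd that])
      have ge: "c \<le> u x" if "\<And>f. f \<in> C \<Longrightarrow> c \<le> f x" for c x
        unfolding u_def by (rule cINF_greatest[OF False that])
      have "sublinear u"
      proof (rule sublinearI)
        fix x y
        have "u (x + y) - f x \<le> g y" if fg: "f \<in> C" "g \<in> C" for f g
        proof -
          \<comment> \<open>The smaller of two comparable functionals, so that one use of
            subadditivity bounds both values.\<close>
          define h where "h = (if f \<le> g then f else g)"
          have h: "h \<in> C" "h x \<le> f x" "h y \<le> g y"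
            using fg tot[OF fg] by (auto simp: h_def le_fun_def)
          have "u (x + y) \<le> h (x + y)" by (rule le[OF h(1)])
          also have "\<dots> \<le> h x + h y" using h(1) CA by (intro sublinear_add) (auto simp: A_def)
          finally show ?thesis using h by simp
        qed
        then have "u (x + y) - f x \<le> u y" if "f \<in> C" for f using that by (intro ge) auto
        then have "u (x + y) - u y \<le> u x" by (intro ge) (simp add: algebra_simps)
        then show "u (x + y) \<le> u x + u y" by simp
      next
        fix c :: real and x :: 'a assume c: "c > 0"
        have "u (c *\<^sub>R x) / c \<le> f x" if "f \<in> C" for f
        proof -
          have "sublinear f" using that CA by (auto simp: A_def)
          then show ?thesis using le[OF that, of "c *\<^sub>R x"] c
            by (simp add: sublinear_scaleR field_simps)
        qed
        then have "u (c *\<^sub>R x) / c \<le> u x" by (rule ge)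
        then show "u (c *\<^sub>R x) \<le> c * u x" using c by (simp add: field_simps)
      next
        have z: "f 0 = 0" if "f \<in> C" for f using that CA by (auto simp: A_def sublinear_zero)
        obtain f where f: "f \<in> C" using False by blast
        show "u 0 = 0"
        proof (rule antisym)
          show "u 0 \<le> 0" using le[OF f, of 0] z[OF f] by simp
          show "0 \<le> u 0" by (intro ge) (simp only: z order_refl)
        qed
      qed
      moreover have "u \<le> p"
      proof -
        obtain f where "f \<in> C" using False by blast
        then have "u \<le> f" "f \<le> p" using le CA by (auto simp: A_def le_fun_def)
        then show ?thesis by simp
      qed
      ultimately show ?thesis using le by (auto simp: A_def le_fun_def)
    qed
  qed
  then obtain m where m: "m \<in> A" and min: "\<And>a. a \<in> A \<Longrightarrow> a \<le> m \<Longrightarrow> a = m" by blast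
  have "linear m"
  proof (rule sublinear_minimal_linear)
    show "sublinear m" using m by (simp add: A_def)
    show "r = m" if "sublinear r" "r \<le> m" for r
      using that m by (intro min) (auto simp: A_def)
  qed
  then show ?thesis using that m by (auto simp: A_def)
qed

text \<open>The norm is cut along \<open>K\<close>, and any linear functional below the result
  separates. For a singleton \<open>K\<close> this provides norming functionals; for larger
  \<open>K\<close> it plays the role of Mazur's theorem.\<close>

theorem hahn_banach_separation:
  fixes K :: "'a::real_normed_vector set"
  assumes K: "convex K" "K \<noteq> {}" and d: "\<And>k. k \<in> K \<Longrightarrow> d \<le> norm k"
  obtains f :: "'a \<Rightarrow>\<^sub>L real" where "norm f \<le> 1" "\<And>k. k \<in> K \<Longrightarrow> d \<le> blinfun_apply f k"
proof -
  obtain q where q: "sublinear q" "q \<le> norm" "\<And>k. k \<in> K \<Longrightarrow> q (- k) \<le> - d"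
    using sublinear_cut[OF sublinear_norm K d] by blast
  obtain f where f: "linear f" "f \<le> q" using hahn_banach_sublinear[OF q(1)] .
  have le: "f x \<le> norm x" for x using f(2) q(2) by (auto simp: le_fun_def intro: order_trans)
  have abs: "\<bar>f x\<bar> \<le> norm x" for x using le[of x] le[of "- x"] by (simp add: linear_neg[OF f(1)])
  have bl: "bounded_linear f"
    using f(1) abs by (intro bounded_linear_intro[of _ 1]) (auto simp: linear_add linear_scale)
  have app: "blinfun_apply (Blinfun f) = f" by (rule bounded_linear_Blinfun_apply[OF bl])
  show ?thesis
  proof (rule that)
    show "norm (Blinfun f) \<le> 1" by (rule norm_blinfun_bound) (use abs in \<open>auto simp: app\<close>)
    fix k assume "k \<in> K"
    then have "f (- k) \<le> - d" using q(3)[of k] f(2) by (auto simp: le_fun_def intro: order_trans)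
    then show "d \<le> blinfun_apply (Blinfun f) k" by (simp add: app linear_neg[OF f(1)])
  qed
qed

text \<open>A minimal nontrivial filter below \<open>F\<close> is an ultrafilter: if it does not
  contain the complement of \<open>P\<close>, then adding \<open>P\<close> leaves it nontrivial,
  hence unchanged.\<close>

lemma ex_ultrafilter_le:
  assumes "F \<noteq> bot"
  obtains U where "ultrafilter U" "U \<le> F"
proof -
  define A where "A = {U. U \<noteq> bot \<and> U \<le> F}"
  have "\<exists>m\<in>A. \<forall>a\<in>A. a \<le> m \<longrightarrow> a = m"
  proof (rule predicate_Zorn)
    show "partial_order_on A (relation_of (\<lambda>f g. g \<le> f) A)"
      by (rule partial_order_on_relation_ofI) auto
  next
    fix C assume C: "C \<in> Chains (relation_of (\<lambda>f g. g \<le> f) A)"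
    have CA: "C \<subseteq> A" using C by (auto simp: Chains_def relation_of_def)
    have tot: "f \<le> g \<or> g \<le> f" if "f \<in> C" "g \<in> C" for f g
      using C that by (auto simp: Chains_def relation_of_def)
    show "\<exists>u\<in>A. \<forall>a\<in>C. u \<le> a"
    proof (cases "C = {}")
      case True
      then show ?thesis using assms by (auto simp: A_def)
    next
      case False
      \<comment> \<open>A chain is directed downwards, so its infimum is trivial only if one of its
        members is.\<close>
      have "eventually (\<lambda>x. False) (Inf C) = (\<exists>b\<in>C. eventually (\<lambda>x. False) b)"
      proof (rule eventually_Inf_base[OF False])
        fix f g assume fg: "f \<in> C" "g \<in> C"
        show "\<exists>x\<in>C. x \<le> inf f g"
          using tot[OF fg] fg by (auto intro: bexI[of _ f] bexI[of _ g])
      qed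
      then have "Inf C \<noteq> bot" using CA by (auto simp: A_def trivial_limit_def)
      moreover have "Inf C \<le> F" using False CA by (auto simp: A_def intro: Inf_lower2)
      ultimately show ?thesis by (auto simp: A_def intro: Inf_lower)
    qed
  qed
  then obtain U where U: "U \<noteq> bot" "U \<le> F"
    and min: "\<And>V. V \<noteq> bot \<Longrightarrow> V \<le> F \<Longrightarrow> V \<le> U \<Longrightarrow> V = U" by (auto simp: A_def)
  have "eventually P U" if "\<not> eventually (\<lambda>i. \<not> P i) U" for P
  proof -
    have "inf U (principal {i. P i}) \<noteq> bot"
      using that by (auto simp: trivial_limit_def eventually_inf_principal)
    then have "inf U (principal {i. P i}) = U"
      using U by (intro min) (auto intro: le_infI1)
    then have "U \<le> principal {i. P i}" by (simp add: inf.absorb_iff1)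
    then show ?thesis by (simp add: le_principal)
  qed
  then have "ultrafilter U" using U by (auto simp: ultrafilter_def)
  then show ?thesis using that U by blast
qed

section \<open>Weak limits and fragmentability of reflexive spaces\<close>

text \<open>The Banach-Alaoglu theorem along an ultrafilter: pointwise limits exist by boundedness,
  and linearity and the norm bound survive the limit.\<close>

lemma ultrafilter_weak_star_limit:
  fixes \<phi> :: "'i \<Rightarrow> 'e::real_normed_vector \<Rightarrow>\<^sub>L real"
  assumes U: "ultrafilter U" and bd: "\<And>i. norm (\<phi> i) \<le> B"
  obtains \<psi> where "\<And>z. ((\<lambda>i. blinfun_apply (\<phi> i) z) \<longlongrightarrow> blinfun_apply \<psi> z) U"
proof -
  have nb: "U \<noteq> bot" using U by (simp add: ultrafilter_def)
  have abs: "\<bar>blinfun_apply (\<phi> i) z\<bar> \<le> B * norm z" for i z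
  proof -
    have "\<bar>blinfun_apply (\<phi> i) z\<bar> \<le> norm (\<phi> i) * norm z"
      using norm_blinfun[of "\<phi> i" z] by simp
    also have "\<dots> \<le> B * norm z" by (rule mult_right_mono[OF bd]) simp
    finally show ?thesis .
  qed
  define f where "f z = Lim U (\<lambda>i. blinfun_apply (\<phi> i) z)" for z
  have lim: "((\<lambda>i. blinfun_apply (\<phi> i) z) \<longlongrightarrow> f z) U" for z
    unfolding f_def by (rule ultrafilter_tendsto_Lim(1)[OF U abs])
  have "bounded_linear f"
  proof (rule bounded_linear_intro)
    fix x y
    show "f (x + y) = f x + f y"
      using tendsto_unique[OF nb lim[of "x + y"]] tendsto_add[OF lim[of x] lim[of y]]
      by (simp add: blinfun.add_right)
  next
    fix c x
    show "f (c *\<^sub>R x) = c *\<^sub>R f x"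
      using tendsto_unique[OF nb lim[of "c *\<^sub>R x"]] tendsto_mult_left[OF lim[of x], of c]
      by (simp add: blinfun.scaleR_right)
  next
    fix x
    show "norm (f x) \<le> norm x * B"
      using ultrafilter_tendsto_Lim(2)[OF U abs[of _ x]] by (simp add: f_def mult.commute)
  qed
  then show ?thesis using that[of "Blinfun f"] lim by (simp add: bounded_linear_Blinfun_apply)
qed

lemma norm_bidual_embedding_le: "norm (bidual_embedding x) \<le> norm x"
proof (rule norm_blinfun_bound)
  fix f :: "'a \<Rightarrow>\<^sub>L real"
  show "norm (blinfun_apply (bidual_embedding x) f) \<le> norm x * norm f"
    using norm_blinfun[of f x] by (simp add: bidual_embedding_apply mult.commute)
qed simp

lemma reflexive_spaceE:
  fixes \<xi> :: "('e::banach \<Rightarrow>\<^sub>L real) \<Rightarrow>\<^sub>L real"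
  assumes "reflexive_space TYPE('e)"
  obtains x where "\<And>\<phi>. blinfun_apply \<xi> \<phi> = blinfun_apply \<phi> x"
proof -
  obtain x where "\<xi> = bidual_embedding x" using assms unfolding reflexive_space_def by blast
  then show ?thesis using that[of x] by (simp add: bidual_embedding_apply)
qed

text \<open>The embedded family has a weak star limit in the bidual, and reflexivity represents that
  limit by a vector.\<close>

lemma reflexive_weak_limit:
  fixes x :: "'i \<Rightarrow> 'e::banach"
  assumes E: "reflexive_space TYPE('e)" and U: "ultrafilter U" and bd: "\<And>i. norm (x i) \<le> B"
  obtains y where "\<And>\<phi> :: 'e \<Rightarrow>\<^sub>L real. ((\<lambda>i. blinfun_apply \<phi> (x i)) \<longlongrightarrow> blinfun_apply \<phi> y) U"
proof -
  have "norm (bidual_embedding (x i)) \<le> B" for i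
    using norm_bidual_embedding_le bd by (rule order_trans)
  then obtain \<xi> where \<xi>:
    "\<And>\<phi>. ((\<lambda>i. blinfun_apply (bidual_embedding (x i)) \<phi>) \<longlongrightarrow> blinfun_apply \<xi> \<phi>) U"
    using ultrafilter_weak_star_limit[OF U] by metis
  obtain y where y: "\<And>\<phi>. blinfun_apply \<xi> \<phi> = blinfun_apply \<phi> y"
    using reflexive_spaceE[OF E] by blast
  show ?thesis by (rule that[of y]) (rule \<xi>[unfolded bidual_embedding_apply y])
qed

text \<open>A functional \<open>F\<close> on the bidual pulls back along the embedding to a
  functional \<open>f\<close> on \<open>'e\<close>. Since every bidual element comes from a vector,
  \<open>F\<close> is evaluation at \<open>f\<close>.\<close>

lemma reflexive_dual:
  assumes "reflexive_space TYPE('e::banach)"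
  shows "reflexive_space TYPE('e \<Rightarrow>\<^sub>L real)"
  unfolding reflexive_space_def
proof (rule surjI)
  fix F :: "(('e \<Rightarrow>\<^sub>L real) \<Rightarrow>\<^sub>L real) \<Rightarrow>\<^sub>L real"
  have bl: "bounded_linear (bidual_embedding :: 'e \<Rightarrow> _)"
    by (rule bounded_linear_intro[of _ 1])
      (auto intro!: blinfun_eqI norm_bidual_embedding_le
        simp: bidual_embedding_apply blinfun.add_left blinfun.scaleR_left blinfun.add_right
          blinfun.scaleR_right)
  define f where "f = F o\<^sub>L Blinfun bidual_embedding"
  have f: "blinfun_apply f x = blinfun_apply F (bidual_embedding x)" for x
    by (simp add: f_def bounded_linear_Blinfun_apply[OF bl])
  show "bidual_embedding f = F"
  proof (rule blinfun_eqI)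
    fix \<xi> :: "('e \<Rightarrow>\<^sub>L real) \<Rightarrow>\<^sub>L real"
    obtain x where "\<xi> = bidual_embedding x" using assms unfolding reflexive_space_def by blast
    then show "blinfun_apply (bidual_embedding f) \<xi> = blinfun_apply F \<xi>"
      by (simp add: bidual_embedding_apply f)
  qed
qed

section \<open>Small weakly open pieces of bounded sets in reflexive spaces\<close>

definition open_polyhedron :: "(('e::real_normed_vector \<Rightarrow>\<^sub>L real) \<times> real) set \<Rightarrow> 'e set" where
  "open_polyhedron H = {x. \<forall>(\<phi>, a)\<in>H. a < blinfun_apply \<phi> x}"

text \<open>For finite \<open>H\<close> the open version is a basic weakly open set; the closed
  version is the one preserved under weak limits.\<close>

definition closed_polyhedron :: "(('e::real_normed_vector \<Rightarrow>\<^sub>L real) \<times> real) set \<Rightarrow> 'e set" where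
  "closed_polyhedron H = {x. \<forall>(\<phi>, a)\<in>H. a \<le> blinfun_apply \<phi> x}"

text \<open>Centres are avoided one at a time. Of two points more than \<open>\<epsilon>\<close>
  apart, one, \<open>w\<close>, is more than \<open>\<epsilon> / 2\<close> away from
  \<open>c\<close>. A norming functional of \<open>w - c\<close> gives a half-space that contains
  \<open>w\<close> and stays \<open>\<epsilon> / 2\<close> away from \<open>c\<close>.\<close>

lemma weakly_open_avoid_finite:
  fixes A :: "'e::real_normed_vector set"
  assumes big: "\<And>H. finite H \<Longrightarrow> A \<inter> open_polyhedron H \<noteq> {} \<Longrightarrow>
      \<exists>x\<in>A \<inter> open_polyhedron H. \<exists>y\<in>A \<inter> open_polyhedron H. dist x y > \<epsilon>"
    and H: "finite H" "A \<inter> open_polyhedron H \<noteq> {}" and N: "finite N"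
  shows "\<exists>H'. finite H' \<and> H \<subseteq> H' \<and> A \<inter> open_polyhedron H' \<noteq> {} \<and>
    (\<forall>z\<in>closed_polyhedron H'. \<forall>c\<in>N. \<epsilon> / 2 \<le> norm (z - c))"
  using N
proof induction
  case empty
  then show ?case using H by auto
next
  case (insert c N)
  then obtain H' where H': "finite H'" "H \<subseteq> H'" "A \<inter> open_polyhedron H' \<noteq> {}"
    and far: "\<forall>z\<in>closed_polyhedron H'. \<forall>c\<in>N. \<epsilon> / 2 \<le> norm (z - c)" by blast
  obtain x y where xy: "x \<in> A \<inter> open_polyhedron H'" "y \<in> A \<inter> open_polyhedron H'" "dist x y > \<epsilon>"
    using big[OF H'(1,3)] by blast
  have "dist x c > \<epsilon> / 2 \<or> dist y c > \<epsilon> / 2"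
    using xy(3) dist_triangle2[of x y c] by linarith
  then obtain w where w: "w \<in> A \<inter> open_polyhedron H'" "norm (w - c) > \<epsilon> / 2"
    using xy by (auto simp: dist_norm)
  obtain f :: "'e \<Rightarrow>\<^sub>L real" where f: "norm f \<le> 1" "norm (w - c) \<le> blinfun_apply f (w - c)"
    using hahn_banach_separation[OF convex_singleton, of "w - c" "norm (w - c)"] by auto
  define H'' where "H'' = insert (f, blinfun_apply f c + \<epsilon> / 2) H'"
  have "w \<in> open_polyhedron H''"
    using w f(2) by (auto simp: H''_def open_polyhedron_def blinfun.diff_right)
  moreover have "\<epsilon> / 2 \<le> norm (z - c)" if "z \<in> closed_polyhedron H''" for z
  proof -
    have "\<epsilon> / 2 \<le> blinfun_apply f (z - c)"
      using that by (auto simp: H''_def closed_polyhedron_def blinfun.diff_right)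
    also have "\<dots> \<le> norm f * norm (z - c)" using norm_blinfun[of f "z - c"] by simp
    also have "\<dots> \<le> 1 * norm (z - c)" by (rule mult_right_mono[OF f(1)]) simp
    finally show ?thesis by simp
  qed
  moreover have "closed_polyhedron H'' \<subseteq> closed_polyhedron H'"
    by (auto simp: H''_def closed_polyhedron_def)
  ultimately show ?case using H' w far
    by (intro exI[of _ H'']) (auto simp: H''_def)
qed

text \<open>A finite \<open>\<epsilon> / 4\<close>-net of \<open>K\<close> reduces this to finitely
  many centres, at the price of half the distance.\<close>

lemma weakly_open_avoid_compact:
  fixes A :: "'e::real_normed_vector set"
  assumes big: "\<And>H. finite H \<Longrightarrow> A \<inter> open_polyhedron H \<noteq> {} \<Longrightarrow>
      \<exists>x\<in>A \<inter> open_polyhedron H. \<exists>y\<in>A \<inter> open_polyhedron H. dist x y > \<epsilon>"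
    and H: "finite H" "A \<inter> open_polyhedron H \<noteq> {}" and K: "compact K" and \<epsilon>: "\<epsilon> > 0"
  shows "\<exists>H'. finite H' \<and> H \<subseteq> H' \<and> A \<inter> open_polyhedron H' \<noteq> {} \<and>
    (\<forall>z\<in>closed_polyhedron H'. \<forall>c\<in>K. \<epsilon> / 4 \<le> norm (z - c))"
proof -
  obtain N where N: "finite N" "K \<subseteq> (\<Union>x\<in>N. ball x (\<epsilon> / 4))"
    using compact_eq_totally_bounded[of K] K \<epsilon> by (meson zero_less_divide_iff zero_less_numeral)
  obtain H' where H': "finite H'" "H \<subseteq> H'" "A \<inter> open_polyhedron H' \<noteq> {}"
    and far: "\<forall>z\<in>closed_polyhedron H'. \<forall>c\<in>N. \<epsilon> / 2 \<le> norm (z - c)"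
    using weakly_open_avoid_finite[OF big H N(1)] by blast
  have "\<epsilon> / 4 \<le> norm (z - c)" if z: "z \<in> closed_polyhedron H'" "c \<in> K" for z c
  proof -
    obtain x where x: "x \<in> N" "dist x c < \<epsilon> / 4" using N(2) z(2) by auto
    have "\<epsilon> / 2 \<le> dist z x" using far z(1) x(1) by (simp add: dist_norm)
    then have "\<epsilon> / 4 \<le> dist z c" using x(2) dist_triangle2[of z x c] by linarith
    then show ?thesis by (simp add: dist_norm)
  qed
  then show ?thesis using H' by blast
qed

text \<open>If every piece is large, one can choose points \<open>y n\<close> whose polyhedra shrink
  and keep away from the convex hull of all earlier points. A weak limit lies in all the closed
  polyhedra, hence at positive distance from the convex hull of the whole sequence, and separation
  contradicts weak convergence.\<close>

theorem reflexive_fragmentable: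
  fixes A :: "'e::banach set"
  assumes E: "reflexive_space TYPE('e)" and A: "A \<noteq> {}" "bounded A" and \<epsilon>: "\<epsilon> > 0"
  shows "\<exists>H. finite H \<and> A \<inter> open_polyhedron H \<noteq> {} \<and>
    (\<forall>x\<in>A \<inter> open_polyhedron H. \<forall>y\<in>A \<inter> open_polyhedron H. dist x y \<le> \<epsilon>)"
proof (rule ccontr)
  assume neg: "\<not> ?thesis"
  then have big: "\<exists>x\<in>A \<inter> open_polyhedron H. \<exists>y\<in>A \<inter> open_polyhedron H. dist x y > \<epsilon>"
    if "finite H" "A \<inter> open_polyhedron H \<noteq> {}" for H
    using that neg by (meson not_le)
  \<comment> \<open>A state consists of the current inequalities, the points chosen so far, and the
    latest point.\<close>
  define P :: "(('e \<Rightarrow>\<^sub>L real) \<times> real) set \<times> 'e set \<times> 'e \<Rightarrow> bool" where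
    "P = (\<lambda>(H, C, y). finite H \<and> finite C \<and> y \<in> C \<and> y \<in> A \<inter> open_polyhedron H)"
  define Q :: "(('e \<Rightarrow>\<^sub>L real) \<times> real) set \<times> 'e set \<times> 'e \<Rightarrow> (('e \<Rightarrow>\<^sub>L real) \<times> real) set \<times> 'e set \<times> 'e \<Rightarrow> bool" where
    "Q = (\<lambda>(H, C, y) (H', C', y'). H \<subseteq> H' \<and> C \<subseteq> C' \<and>
       (\<forall>z\<in>closed_polyhedron H'. \<forall>c\<in>convex hull C. \<epsilon> / 4 \<le> norm (z - c)))"
  have "\<exists>f. \<forall>n. P (f n) \<and> Q (f n) (f (Suc n))"
  proof (rule dependent_nat_choice)
    obtain a where "a \<in> A" using A by blast
    then have "P ({}, {a}, a)" by (simp add: P_def open_polyhedron_def)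
    then show "\<exists>s. P s" ..
  next
    fix s n assume "P s"
    moreover obtain H C y where s: "s = (H, C, y)" by (cases s)
    ultimately have HC: "finite H" "finite C" "A \<inter> open_polyhedron H \<noteq> {}" by (auto simp: P_def)
    obtain H' where H': "finite H'" "H \<subseteq> H'" "A \<inter> open_polyhedron H' \<noteq> {}"
      "\<forall>z\<in>closed_polyhedron H'. \<forall>c\<in>convex hull C. \<epsilon> / 4 \<le> norm (z - c)"
      using weakly_open_avoid_compact[OF big HC(1,3) finite_imp_compact_convex_hull[OF HC(2)] \<epsilon>]
      by blast
    then obtain y' where "y' \<in> A \<inter> open_polyhedron H'" by blast
    then have "P (H', insert y' C, y')" "Q s (H', insert y' C, y')"
      using H' HC by (auto simp: P_def Q_def s)
    then show "\<exists>s'. P s' \<and> Q s s'" by blast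
  qed
  then obtain f where f: "\<And>n. P (f n)" "\<And>n. Q (f n) (f (Suc n))" by blast
  define H where "H n = fst (f n)" for n
  define C where "C n = fst (snd (f n))" for n
  define y where "y n = snd (snd (f n))" for n
  have y: "y n \<in> A" "y n \<in> open_polyhedron (H n)" "y n \<in> C n" for n
    using f(1)[of n] by (auto simp: P_def H_def C_def y_def split: prod.splits)
  have step: "H n \<subseteq> H (Suc n)" "C n \<subseteq> C (Suc n)"
    "\<And>z c. z \<in> closed_polyhedron (H (Suc n)) \<Longrightarrow> c \<in> convex hull (C n) \<Longrightarrow> \<epsilon> / 4 \<le> norm (z - c)" for n
    using f(2)[of n] by (auto simp: Q_def H_def C_def split: prod.splits)
  have Hmono: "H m \<subseteq> H n" if "m \<le> n" for m n using lift_Suc_mono_le[of H, OF step(1) that] .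
  have Cmono: "C m \<subseteq> C n" if "m \<le> n" for m n using lift_Suc_mono_le[of C, OF step(2) that] .
  obtain R where R: "\<And>x. x \<in> A \<Longrightarrow> norm x \<le> R" using A(2) by (auto simp: bounded_iff)
  \<comment> \<open>Refining \<open>sequentially\<close> lets inequalities that hold for all late
    \<open>y m\<close> pass to the limit.\<close>
  obtain U :: "nat filter" where U: "ultrafilter U" "U \<le> sequentially"
    using ex_ultrafilter_le[OF sequentially_bot] .
  have nb: "U \<noteq> bot" using U by (simp add: ultrafilter_def)
  obtain x where x: "\<And>\<phi> :: 'e \<Rightarrow>\<^sub>L real. ((\<lambda>i. blinfun_apply \<phi> (y i)) \<longlongrightarrow> blinfun_apply \<phi> x) U"
    using reflexive_weak_limit[OF E U(1), of y R] R y(1) by blast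
  have xH: "x \<in> closed_polyhedron (H n)" for n
    unfolding closed_polyhedron_def
  proof safe
    fix \<phi> a assume *: "(\<phi>, a) \<in> H n"
    have "a \<le> blinfun_apply \<phi> (y m)" if "n \<le> m" for m
      using y(2)[of m] Hmono[OF that] * by (force simp: open_polyhedron_def)
    then have "eventually (\<lambda>m. a \<le> blinfun_apply \<phi> (y m)) sequentially"
      by (auto intro: eventually_sequentiallyI)
    then have "eventually (\<lambda>m. a \<le> blinfun_apply \<phi> (y m)) U" using U(2) by (simp add: filter_leD)
    then show "a \<le> blinfun_apply \<phi> x" by (rule tendsto_lowerbound[OF x _ nb])
  qed
  \<comment> \<open>The hulls increase with \<open>n\<close>, so their union is convex, and it
    contains every \<open>y n\<close>.\<close>
  define K where "K = (\<Union>n. convex hull (C n))"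
  have hull_mono': "convex hull (C m) \<subseteq> convex hull (C n)" if "m \<le> n" for m n
    by (rule hull_mono[OF Cmono[OF that]])
  have "convex K"
  proof (rule convexI)
    fix a b and u v :: real
    assume ab: "a \<in> K" "b \<in> K" and uv: "0 \<le> u" "0 \<le> v" "u + v = 1"
    obtain m n where "a \<in> convex hull (C m)" "b \<in> convex hull (C n)" using ab by (auto simp: K_def)
    then have "a \<in> convex hull (C (max m n))" "b \<in> convex hull (C (max m n))"
      using hull_mono'[of m "max m n"] hull_mono'[of n "max m n"] by auto
    then have "u *\<^sub>R a + v *\<^sub>R b \<in> convex hull (C (max m n))"
      using uv by (intro convexD[OF convex_convex_hull])
    then show "u *\<^sub>R a + v *\<^sub>R b \<in> K" by (auto simp: K_def)
  qed
  then have conv: "convex ((\<lambda>k. k - x) ` K)" by (rule convex_translation_subtract)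
  have yK: "y n \<in> K" for n unfolding K_def by (rule UN_I[of n]) (simp_all add: hull_inc y(3))
  have far: "\<epsilon> / 4 \<le> norm k" if "k \<in> (\<lambda>k. k - x) ` K" for k
    using that step(3)[OF xH] by (auto simp: K_def norm_minus_commute)
  obtain g :: "'e \<Rightarrow>\<^sub>L real" where g: "\<And>k. k \<in> (\<lambda>k. k - x) ` K \<Longrightarrow> \<epsilon> / 4 \<le> blinfun_apply g k"
    using hahn_banach_separation[OF conv _ far] yK by blast
  \<comment> \<open>\<open>g\<close> keeps the whole sequence \<open>\<epsilon> / 4\<close> above
    its value at \<open>x\<close>, although \<open>g (y n)\<close> tends to \<open>g x\<close> along
    \<open>U\<close>.\<close>
  have "blinfun_apply g x + \<epsilon> / 4 \<le> blinfun_apply g (y n)" for n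
    using g[of "y n - x"] yK by (simp add: blinfun.diff_right)
  then have "blinfun_apply g x + \<epsilon> / 4 \<le> blinfun_apply g x"
    by (intro tendsto_lowerbound[OF x _ nb]) simp
  then show False using \<epsilon> by simp
qed

text \<open>A small weakly open piece of the orbit of \<open>v\<close> contains some
  \<open>R v\<close>. If \<open>S\<close> hardly moves \<open>v\<close> against the functionals
  pulled back along \<open>R\<close>, then \<open>R (S v)\<close> lies in the same piece, and the
  isometry \<open>R\<close> carries the estimate back to \<open>S v - v\<close>. Asking for a set
  closed under composition lets this cover the order-reversing action on the dual too.\<close>

theorem isometries_weak_imp_strong:
  fixes T :: "('e::banach \<Rightarrow>\<^sub>L 'e) set"
  assumes E: "reflexive_space TYPE('e)" and ne: "T \<noteq> {}"
    and iso: "\<And>S v. S \<in> T \<Longrightarrow> norm (blinfun_apply S v) = norm v"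
    and comp: "\<And>R S. R \<in> T \<Longrightarrow> S \<in> T \<Longrightarrow> R o\<^sub>L S \<in> T"
    and \<epsilon>: "\<epsilon> > 0"
  shows "\<exists>(\<Psi> :: ('e \<Rightarrow>\<^sub>L real) set) \<eta>. finite \<Psi> \<and> \<eta> > 0 \<and>
    (\<forall>S\<in>T. (\<forall>\<psi>\<in>\<Psi>. \<bar>blinfun_apply \<psi> (blinfun_apply S v - v)\<bar> < \<eta>) \<longrightarrow>
      norm (blinfun_apply S v - v) \<le> \<epsilon>)"
proof -
  define A where "A = (\<lambda>S. blinfun_apply S v) ` T"
  have "A \<noteq> {}" "bounded A" using ne iso by (auto simp: A_def bounded_iff)
  then obtain H where H: "finite H" "A \<inter> open_polyhedron H \<noteq> {}"
    "\<forall>x\<in>A \<inter> open_polyhedron H. \<forall>y\<in>A \<inter> open_polyhedron H. dist x y \<le> \<epsilon>"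
    using reflexive_fragmentable[OF E _ _ \<epsilon>, of A] by blast
  then obtain R where R: "R \<in> T" "blinfun_apply R v \<in> open_polyhedron H" by (auto simp: A_def)
  define \<Psi> where "\<Psi> = (\<lambda>(\<phi>, a). \<phi> o\<^sub>L R) ` H"
  \<comment> \<open>The smallest margin in the inequalities satisfied by \<open>R v\<close>; the
    entry 1 covers empty \<open>H\<close>.\<close>
  define \<eta> where "\<eta> = Min (insert 1 ((\<lambda>(\<phi>, a). blinfun_apply \<phi> (blinfun_apply R v) - a) ` H))"
  show ?thesis
  proof (intro exI[of _ \<Psi>] exI[of _ \<eta>] conjI ballI impI)
    show "finite \<Psi>" using H by (simp add: \<Psi>_def)
    show "\<eta> > 0" unfolding \<eta>_def
      by (subst Min_gr_iff) (use H R in \<open>auto simp: open_polyhedron_def\<close>)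
    fix S assume S: "S \<in> T"
      and small: "\<forall>\<psi>\<in>\<Psi>. \<bar>blinfun_apply \<psi> (blinfun_apply S v - v)\<bar> < \<eta>"
    have "blinfun_apply (R o\<^sub>L S) v \<in> open_polyhedron H"
      unfolding open_polyhedron_def
    proof safe
      fix \<phi> a assume Ha: "(\<phi>, a) \<in> H"
      have "\<eta> \<le> blinfun_apply \<phi> (blinfun_apply R v) - a"
        unfolding \<eta>_def using H Ha by (intro Min_le) force+
      moreover have "\<bar>blinfun_apply (\<phi> o\<^sub>L R) (blinfun_apply S v - v)\<bar> < \<eta>"
        using Ha by (intro bspec[OF small]) (force simp: \<Psi>_def)
      ultimately show "a < blinfun_apply \<phi> (blinfun_apply (R o\<^sub>L S) v)"
        by (simp add: blinfun.diff_right)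
    qed
    then have "dist (blinfun_apply (R o\<^sub>L S) v) (blinfun_apply R v) \<le> \<epsilon>"
      using H(3) R comp[OF R(1) S] unfolding A_def by blast
    then show "norm (blinfun_apply S v - v) \<le> \<epsilon>"
      using iso[OF R(1), of "blinfun_apply S v - v"] by (simp add: dist_norm blinfun.diff_right)
  qed
qed

section \<open>Exchange of ultrafilter limits\<close>

lemma ultrafilter_LimI: "ultrafilter U \<Longrightarrow> (f \<longlongrightarrow> l) U \<Longrightarrow> Lim U f = l"
  unfolding ultrafilter_def by (rule tendsto_Lim) simp_all

lemma ultrafilter_Lim_add:
  fixes f g :: "'i \<Rightarrow> real"
  assumes "ultrafilter U" "\<And>i. \<bar>f i\<bar> \<le> B" "\<And>i. \<bar>g i\<bar> \<le> C"
  shows "Lim U (\<lambda>i. f i + g i) = Lim U f + Lim U g"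
  by (rule ultrafilter_LimI[OF assms(1) tendsto_add[OF ultrafilter_tendsto_Lim(1)[OF assms(1,2)]
        ultrafilter_tendsto_Lim(1)[OF assms(1,3)]]])

lemma ultrafilter_Lim_comp:
  fixes f :: "'i \<Rightarrow> real"
  assumes "ultrafilter U" "\<And>i. \<bar>f i\<bar> \<le> B" "continuous_on UNIV h"
  shows "Lim U (\<lambda>i. h (f i)) = h (Lim U f)"
proof (rule ultrafilter_LimI[OF assms(1)])
  have "isCont h (Lim U f)" using assms(3) by (simp add: continuous_on_eq_continuous_at)
  then show "((\<lambda>i. h (f i)) \<longlongrightarrow> h (Lim U f)) U"
    by (rule isCont_tendsto_compose[OF _ ultrafilter_tendsto_Lim(1)[OF assms(1,2)]])
qed

lemma ultrafilter_Lim_dist: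
  fixes f g :: "'i \<Rightarrow> real"
  assumes U: "ultrafilter U" and "\<And>i. \<bar>f i\<bar> \<le> B" "\<And>i. \<bar>g i\<bar> \<le> C" and e: "\<And>i. \<bar>f i - g i\<bar> \<le> e"
  shows "\<bar>Lim U f - Lim U g\<bar> \<le> e"
proof -
  have "Lim U (\<lambda>i. f i - g i) = Lim U f - Lim U g"
    by (rule ultrafilter_LimI[OF U tendsto_diff[OF ultrafilter_tendsto_Lim(1)[OF assms(1,2)]
          ultrafilter_tendsto_Lim(1)[OF assms(1,3)]]])
  then show ?thesis using ultrafilter_tendsto_Lim(2)[OF U, of "\<lambda>i. f i - g i", OF e] by simp
qed

text \<open>Grothendieck's double limit condition for one kernel and one pair of ultrafilters,
  isolated so that sums, continuous images and uniform limits can be treated separately.\<close>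

definition Lim_exchange :: "'i filter \<Rightarrow> 'j filter \<Rightarrow> ('i \<Rightarrow> 'j \<Rightarrow> real) \<Rightarrow> bool" where
  "Lim_exchange U V F \<longleftrightarrow>
     Lim U (\<lambda>n. Lim V (\<lambda>m. F n m)) = Lim V (\<lambda>m. Lim U (\<lambda>n. F n m))"

lemma Lim_exchange_add:
  assumes U: "ultrafilter U" and V: "ultrafilter V"
    and F: "\<And>n m. \<bar>F n m\<bar> \<le> B" and F': "\<And>n m. \<bar>F' n m\<bar> \<le> C"
    and "Lim_exchange U V F" "Lim_exchange U V F'"
  shows "Lim_exchange U V (\<lambda>n m. F n m + F' n m)"
proof -
  \<comment> \<open>The inner limits inherit the bounds of the kernels, so the outer limits exist as
    well.\<close>
  note UB = ultrafilter_tendsto_Lim(2)[OF U]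
  note VB = ultrafilter_tendsto_Lim(2)[OF V]
  have "Lim U (\<lambda>n. Lim V (\<lambda>m. F n m + F' n m)) =
      Lim U (\<lambda>n. Lim V (\<lambda>m. F n m)) + Lim U (\<lambda>n. Lim V (\<lambda>m. F' n m))"
    unfolding ultrafilter_Lim_add[OF V F F'] ultrafilter_Lim_add[OF U VB[OF F] VB[OF F']] ..
  moreover have "Lim V (\<lambda>m. Lim U (\<lambda>n. F n m + F' n m)) =
      Lim V (\<lambda>m. Lim U (\<lambda>n. F n m)) + Lim V (\<lambda>m. Lim U (\<lambda>n. F' n m))"
    unfolding ultrafilter_Lim_add[OF U F F'] ultrafilter_Lim_add[OF V UB[OF F] UB[OF F']] ..
  ultimately show ?thesis using assms(5,6) by (simp add: Lim_exchange_def)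
qed

lemma Lim_exchange_comp:
  assumes U: "ultrafilter U" and V: "ultrafilter V"
    and F: "\<And>n m. \<bar>F n m\<bar> \<le> B" and "Lim_exchange U V F" and h: "continuous_on UNIV h"
  shows "Lim_exchange U V (\<lambda>n m. h (F n m))"
proof -
  note UB = ultrafilter_tendsto_Lim(2)[OF U]
  note VB = ultrafilter_tendsto_Lim(2)[OF V]
  have "Lim U (\<lambda>n. Lim V (\<lambda>m. h (F n m))) = h (Lim U (\<lambda>n. Lim V (\<lambda>m. F n m)))"
    unfolding ultrafilter_Lim_comp[OF V F h] ultrafilter_Lim_comp[OF U VB[OF F] h] ..
  moreover have "Lim V (\<lambda>m. Lim U (\<lambda>n. h (F n m))) = h (Lim V (\<lambda>m. Lim U (\<lambda>n. F n m)))"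
    unfolding ultrafilter_Lim_comp[OF U F h] ultrafilter_Lim_comp[OF V UB[OF F] h] ..
  ultimately show ?thesis using assms(4) by (simp add: Lim_exchange_def)
qed

text \<open>Either iterated limit changes by at most \<open>e\<close> under a uniform change of the
  kernel by \<open>e\<close>, so the two differ by less than any positive number.\<close>

lemma Lim_exchange_uniform_limit:
  assumes U: "ultrafilter U" and V: "ultrafilter V"
    and F: "\<And>n m. \<bar>F n m\<bar> \<le> B"
    and approx: "\<And>e. e > 0 \<Longrightarrow>
      \<exists>F' C. Lim_exchange U V F' \<and> (\<forall>n m. \<bar>F' n m\<bar> \<le> C \<and> \<bar>F n m - F' n m\<bar> \<le> e)"
  shows "Lim_exchange U V F"
proof -
  note UB = ultrafilter_tendsto_Lim(2)[OF U]
  note VB = ultrafilter_tendsto_Lim(2)[OF V]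
  let ?l = "Lim U (\<lambda>n. Lim V (\<lambda>m. F n m))" and ?r = "Lim V (\<lambda>m. Lim U (\<lambda>n. F n m))"
  have "\<bar>?l - ?r\<bar> \<le> e" if e: "e > 0" for e
  proof -
    obtain F' C where F': "Lim_exchange U V F'" "\<And>n m. \<bar>F' n m\<bar> \<le> C"
      "\<And>n m. \<bar>F n m - F' n m\<bar> \<le> e / 2" using approx[of "e / 2"] e by (meson half_gt_zero)
    have "\<bar>?l - Lim U (\<lambda>n. Lim V (\<lambda>m. F' n m))\<bar> \<le> e / 2"
      by (rule ultrafilter_Lim_dist[OF U VB[OF F] VB[OF F'(2)]
            ultrafilter_Lim_dist[OF V F F'(2) F'(3)]])
    moreover have "\<bar>?r - Lim V (\<lambda>m. Lim U (\<lambda>n. F' n m))\<bar> \<le> e / 2"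
      by (rule ultrafilter_Lim_dist[OF V UB[OF F] UB[OF F'(2)]
            ultrafilter_Lim_dist[OF U F F'(2) F'(3)]])
    ultimately show ?thesis using F'(1) unfolding Lim_exchange_def by linarith
  qed
  then have "\<bar>?l - ?r\<bar> \<le> 0" using dense_ge[of 0 "\<bar>?l - ?r\<bar>"] by blast
  then show ?thesis by (simp add: Lim_exchange_def)
qed

text \<open>With \<open>\<psi>\<close> the weak star limit of the functionals and \<open>y\<close>
  the weak limit of the vectors, both iterated limits equal \<open>\<psi>\<close> at
  \<open>y\<close>.\<close>

lemma Lim_exchange_pairing:
  fixes \<phi> :: "'i \<Rightarrow> 'e::banach \<Rightarrow>\<^sub>L real" and x :: "'j \<Rightarrow> 'e"
  assumes E: "reflexive_space TYPE('e)" and U: "ultrafilter U" and V: "ultrafilter V"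
    and \<phi>: "\<And>n. norm (\<phi> n) \<le> B" and x: "\<And>m. norm (x m) \<le> C"
  shows "Lim_exchange U V (\<lambda>n m. blinfun_apply (\<phi> n) (x m))"
proof -
  obtain \<psi> where \<psi>: "\<And>z. ((\<lambda>n. blinfun_apply (\<phi> n) z) \<longlongrightarrow> blinfun_apply \<psi> z) U"
    using ultrafilter_weak_star_limit[where \<phi> = \<phi>, OF U \<phi>] by blast
  obtain y where y: "\<And>\<phi>' :: 'e \<Rightarrow>\<^sub>L real. ((\<lambda>m. blinfun_apply \<phi>' (x m)) \<longlongrightarrow> blinfun_apply \<phi>' y) V"
    using reflexive_weak_limit[where x = x, OF E V x] by blast
  show ?thesis
    unfolding Lim_exchange_def ultrafilter_LimI[OF V y] ultrafilter_LimI[OF U \<psi>] ..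
qed

section \<open>Weakly almost periodic functions\<close>

lemma blinfun_compose_assoc: "(f o\<^sub>L g) o\<^sub>L h = f o\<^sub>L (g o\<^sub>L h)"
  by (rule blinfun_eqI) simp

lemma add_one_mult_less: "0 \<le> c \<Longrightarrow> x < e / (c + 1) \<Longrightarrow> (c + 1) * x < e" for c :: real
  by (simp add: pos_less_divide_eq mult.commute)

locale metric_group = group G + Metric_space "carrier G" d
  for G :: "('a, 'b) monoid_scheme" (structure) and d +
  assumes left_inv: "left_invariant G d"
begin

lemma d_mult_left: "g \<in> carrier G \<Longrightarrow> x \<in> carrier G \<Longrightarrow> y \<in> carrier G \<Longrightarrow> d (g \<otimes> x) (g \<otimes> y) = d x y"
  using left_inv by (simp add: left_invariant_def)

lemma d_one_inv_mult: "x \<in> carrier G \<Longrightarrow> y \<in> carrier G \<Longrightarrow> d \<one> (inv x \<otimes> y) = d x y"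
  using d_mult_left[of "inv x" x y] by simp

lemma d_one_inv: "g \<in> carrier G \<Longrightarrow> d \<one> (inv g) = d \<one> g"
  using d_one_inv_mult[of g \<one>] commute[of g \<one>] by simp

text \<open>Weak almost periodicity in the form of the double limit criterion. Uniform continuity
  under both left and right translations is included because the triangle inequality for
  \<open>len\<close> translates by a short factor on either side.\<close>

definition wap :: "('a \<Rightarrow> real) \<Rightarrow> bool" where
  "wap f \<longleftrightarrow>
     (\<exists>B. \<forall>g\<in>carrier G. \<bar>f g\<bar> \<le> B) \<and>
     (\<forall>\<epsilon>>0. \<exists>\<eta>>0. \<forall>k\<in>carrier G. d \<one> k < \<eta> \<longrightarrow>
        (\<forall>g\<in>carrier G. \<bar>f (g \<otimes> k) - f g\<bar> < \<epsilon> \<and> \<bar>f (k \<otimes> g) - f g\<bar> < \<epsilon>)) \<and>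
     (\<forall>(s :: nat \<Rightarrow> 'a) (t :: nat \<Rightarrow> 'a) U V.
        range s \<subseteq> carrier G \<longrightarrow> range t \<subseteq> carrier G \<longrightarrow> ultrafilter U \<longrightarrow> ultrafilter V \<longrightarrow>
        Lim_exchange U V (\<lambda>n m. f (inv (s n) \<otimes> t m)))"

lemma wap_bounded:
  assumes "wap f"
  obtains B where "B \<ge> 0" "\<And>g. g \<in> carrier G \<Longrightarrow> \<bar>f g\<bar> \<le> B"
proof -
  obtain B where B: "\<And>g. g \<in> carrier G \<Longrightarrow> \<bar>f g\<bar> \<le> B" using assms by (auto simp: wap_def)
  have "0 \<le> B" using B[OF one_closed] by linarith
  then show ?thesis using that B by blast
qed

lemma wap_uniform:
  assumes "wap f" "\<epsilon> > 0"
  obtains \<eta> where "\<eta> > 0" "\<And>g k. g \<in> carrier G \<Longrightarrow> k \<in> carrier G \<Longrightarrow> d \<one> k < \<eta> \<Longrightarrow>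
    \<bar>f (g \<otimes> k) - f g\<bar> < \<epsilon> \<and> \<bar>f (k \<otimes> g) - f g\<bar> < \<epsilon>"
proof -
  obtain \<eta> where "\<eta> > 0" "\<forall>k\<in>carrier G. d \<one> k < \<eta> \<longrightarrow>
      (\<forall>g\<in>carrier G. \<bar>f (g \<otimes> k) - f g\<bar> < \<epsilon> \<and> \<bar>f (k \<otimes> g) - f g\<bar> < \<epsilon>)"
    using assms by (auto simp only: wap_def)
  then show ?thesis by (intro that) auto
qed

lemma wap_exchange:
  "wap f \<Longrightarrow> range s \<subseteq> carrier G \<Longrightarrow> range t \<subseteq> carrier G \<Longrightarrow> ultrafilter U \<Longrightarrow> ultrafilter V \<Longrightarrow>
    Lim_exchange U V (\<lambda>n m. f (inv (s n) \<otimes> t m))" for s t :: "nat \<Rightarrow> 'a"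
  by (simp add: wap_def)

lemma wapI:
  assumes "\<And>g. g \<in> carrier G \<Longrightarrow> \<bar>f g\<bar> \<le> B"
    and "\<And>\<epsilon>. \<epsilon> > 0 \<Longrightarrow> \<exists>\<eta>>0. \<forall>k\<in>carrier G. d \<one> k < \<eta> \<longrightarrow>
        (\<forall>g\<in>carrier G. \<bar>f (g \<otimes> k) - f g\<bar> < \<epsilon> \<and> \<bar>f (k \<otimes> g) - f g\<bar> < \<epsilon>)"
    and "\<And>(s :: nat \<Rightarrow> 'a) (t :: nat \<Rightarrow> 'a) (U :: nat filter) (V :: nat filter).
      range s \<subseteq> carrier G \<Longrightarrow> range t \<subseteq> carrier G \<Longrightarrow> ultrafilter U \<Longrightarrow> ultrafilter V \<Longrightarrow> Lim_exchange U V (\<lambda>n m. f (inv (s n) \<otimes> t m))"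
  shows "wap f"
  unfolding wap_def
proof (intro conjI)
  show "\<exists>B. \<forall>g\<in>carrier G. \<bar>f g\<bar> \<le> B" using assms(1) by blast
qed (use assms(2,3) in simp_all)

lemma wap_const: "wap (\<lambda>g. c)"
  by (rule wapI[of _ "\<bar>c\<bar>"])
    (auto simp: Lim_exchange_def ultrafilter_LimI[OF _ tendsto_const] intro: exI[of _ 1])

lemma wap_add:
  assumes "wap f" "wap h"
  shows "wap (\<lambda>g. f g + h g)"
proof -
  obtain B where B: "\<And>g. g \<in> carrier G \<Longrightarrow> \<bar>f g\<bar> \<le> B" using wap_bounded[OF assms(1)] by blast
  obtain C where C: "\<And>g. g \<in> carrier G \<Longrightarrow> \<bar>h g\<bar> \<le> C" using wap_bounded[OF assms(2)] by blast
  show ?thesis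
  proof (rule wapI)
    show "\<bar>f g + h g\<bar> \<le> B + C" if "g \<in> carrier G" for g using B[OF that] C[OF that] by linarith
  next
    fix \<epsilon> :: real assume "\<epsilon> > 0"
    then have \<epsilon>: "\<epsilon> / 2 > 0" by simp
    obtain \<eta>1 where 1: "\<eta>1 > 0" "\<And>g k. g \<in> carrier G \<Longrightarrow> k \<in> carrier G \<Longrightarrow> d \<one> k < \<eta>1 \<Longrightarrow>
      \<bar>f (g \<otimes> k) - f g\<bar> < \<epsilon> / 2 \<and> \<bar>f (k \<otimes> g) - f g\<bar> < \<epsilon> / 2"
      using wap_uniform[OF assms(1) \<epsilon>] by blast
    obtain \<eta>2 where 2: "\<eta>2 > 0" "\<And>g k. g \<in> carrier G \<Longrightarrow> k \<in> carrier G \<Longrightarrow> d \<one> k < \<eta>2 \<Longrightarrow>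
      \<bar>h (g \<otimes> k) - h g\<bar> < \<epsilon> / 2 \<and> \<bar>h (k \<otimes> g) - h g\<bar> < \<epsilon> / 2"
      using wap_uniform[OF assms(2) \<epsilon>] by blast
    show "\<exists>\<eta>>0. \<forall>k\<in>carrier G. d \<one> k < \<eta> \<longrightarrow> (\<forall>g\<in>carrier G.
        \<bar>f (g \<otimes> k) + h (g \<otimes> k) - (f g + h g)\<bar> < \<epsilon> \<and> \<bar>f (k \<otimes> g) + h (k \<otimes> g) - (f g + h g)\<bar> < \<epsilon>)"
    proof (intro exI[of _ "min \<eta>1 \<eta>2"] conjI ballI impI)
      fix k g assume kg: "k \<in> carrier G" "d \<one> k < min \<eta>1 \<eta>2" "g \<in> carrier G"
      have "\<bar>f (g \<otimes> k) - f g\<bar> < \<epsilon> / 2" "\<bar>h (g \<otimes> k) - h g\<bar> < \<epsilon> / 2"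
        using 1(2)[of g k] 2(2)[of g k] kg by auto
      then show "\<bar>f (g \<otimes> k) + h (g \<otimes> k) - (f g + h g)\<bar> < \<epsilon>" by linarith
      have "\<bar>f (k \<otimes> g) - f g\<bar> < \<epsilon> / 2" "\<bar>h (k \<otimes> g) - h g\<bar> < \<epsilon> / 2"
        using 1(2)[of g k] 2(2)[of g k] kg by auto
      then show "\<bar>f (k \<otimes> g) + h (k \<otimes> g) - (f g + h g)\<bar> < \<epsilon>" by linarith
    qed (use 1 2 in simp)
  next
    fix s t :: "nat \<Rightarrow> 'a" and U V :: "nat filter"
    assume st: "range s \<subseteq> carrier G" "range t \<subseteq> carrier G" and UV: "ultrafilter U" "ultrafilter V"
    have "s n \<in> carrier G" "t n \<in> carrier G" for n using st by auto
    then have "inv (s n) \<otimes> t m \<in> carrier G" for n m by simp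
    then show "Lim_exchange U V (\<lambda>n m. f (inv (s n) \<otimes> t m) + h (inv (s n) \<otimes> t m))"
      by (intro Lim_exchange_add[OF UV B C wap_exchange[OF assms(1) st UV]
            wap_exchange[OF assms(2) st UV]])
  qed
qed

lemma wap_sum: "finite I \<Longrightarrow> (\<And>i. i \<in> I \<Longrightarrow> wap (f i)) \<Longrightarrow> wap (\<lambda>g. \<Sum>i\<in>I. f i g)"
  by (induction I rule: finite_induct) (simp_all add: wap_add wap_const)

lemma wap_comp:
  fixes h :: "real \<Rightarrow> real"
  assumes f: "wap f" and h: "L-lipschitz_on UNIV h"
  shows "wap (\<lambda>g. h (f g))"
proof -
  obtain B where B: "B \<ge> 0" "\<And>g. g \<in> carrier G \<Longrightarrow> \<bar>f g\<bar> \<le> B" using wap_bounded[OF f] by blast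
  have L: "L \<ge> 0" by (rule lipschitz_on_nonneg[OF h])
  have lip: "\<bar>h x - h y\<bar> \<le> L * \<bar>x - y\<bar>" for x y using lipschitz_onD[OF h] by (simp add: dist_real_def)
  show ?thesis
  proof (rule wapI)
    fix g assume g: "g \<in> carrier G"
    have "\<bar>h (f g) - h 0\<bar> \<le> L * B"
      using lip[of "f g" 0] mult_left_mono[OF B(2)[OF g] L] by simp
    then show "\<bar>h (f g)\<bar> \<le> L * B + \<bar>h 0\<bar>" by linarith
  next
    fix \<epsilon> :: real assume \<epsilon>: "\<epsilon> > 0"
    \<comment> \<open>The denominator \<open>L + 1\<close> covers the Lipschitz constant 0.\<close>
    have e: "\<epsilon> / (L + 1) > 0" using \<epsilon> L by simp
    obtain \<eta> where \<eta>: "\<eta> > 0" "\<And>g k. g \<in> carrier G \<Longrightarrow> k \<in> carrier G \<Longrightarrow> d \<one> k < \<eta> \<Longrightarrow>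
      \<bar>f (g \<otimes> k) - f g\<bar> < \<epsilon> / (L + 1) \<and> \<bar>f (k \<otimes> g) - f g\<bar> < \<epsilon> / (L + 1)"
      using wap_uniform[OF f e] by blast
    have "\<bar>h x - h y\<bar> < \<epsilon>" if "\<bar>x - y\<bar> < \<epsilon> / (L + 1)" for x y
    proof -
      have "\<bar>h x - h y\<bar> \<le> (L + 1) * \<bar>x - y\<bar>" using lip[of x y] L by (simp add: algebra_simps)
      also have "\<dots> < \<epsilon>" using that L by (simp add: field_simps)
      finally show ?thesis .
    qed
    then show "\<exists>\<eta>>0. \<forall>k\<in>carrier G. d \<one> k < \<eta> \<longrightarrow> (\<forall>g\<in>carrier G.
        \<bar>h (f (g \<otimes> k)) - h (f g)\<bar> < \<epsilon> \<and> \<bar>h (f (k \<otimes> g)) - h (f g)\<bar> < \<epsilon>)"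
      using \<eta> by blast
  next
    fix s t :: "nat \<Rightarrow> 'a" and U V :: "nat filter"
    assume st: "range s \<subseteq> carrier G" "range t \<subseteq> carrier G" and UV: "ultrafilter U" "ultrafilter V"
    have "s n \<in> carrier G" "t n \<in> carrier G" for n using st by auto
    then have "inv (s n) \<otimes> t m \<in> carrier G" for n m by simp
    then show "Lim_exchange U V (\<lambda>n m. h (f (inv (s n) \<otimes> t m)))"
      by (intro Lim_exchange_comp[OF UV B(2) wap_exchange[OF f st UV]
            lipschitz_on_continuous_on[OF h]])
  qed
qed

lemma wap_cmult: "wap f \<Longrightarrow> wap (\<lambda>g. c * f g)" for c :: real
  by (rule wap_comp[where L = "\<bar>c\<bar>"], assumption, rule lipschitz_onI)
    (simp_all add: dist_real_def flip: abs_mult right_diff_distrib)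

text \<open>Inversion interchanges left and right translations as well as the two sequences, so the
  exchange property of \<open>f\<close> is used with \<open>U\<close> and \<open>V\<close> swapped.
  Balls around the identity are symmetric by left invariance.\<close>

lemma wap_inv:
  assumes f: "wap f"
  shows "wap (\<lambda>g. f (inv g))"
proof -
  obtain B where B: "\<And>g. g \<in> carrier G \<Longrightarrow> \<bar>f g\<bar> \<le> B" using wap_bounded[OF f] by blast
  show ?thesis
  proof (rule wapI)
    show "\<bar>f (inv g)\<bar> \<le> B" if "g \<in> carrier G" for g using B that by simp
  next
    fix \<epsilon> :: real assume \<epsilon>: "\<epsilon> > 0"
    obtain \<eta> where \<eta>: "\<eta> > 0" "\<And>g k. g \<in> carrier G \<Longrightarrow> k \<in> carrier G \<Longrightarrow> d \<one> k < \<eta> \<Longrightarrow>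
      \<bar>f (g \<otimes> k) - f g\<bar> < \<epsilon> \<and> \<bar>f (k \<otimes> g) - f g\<bar> < \<epsilon>"
      using wap_uniform[OF f \<epsilon>] by blast
    show "\<exists>\<eta>>0. \<forall>k\<in>carrier G. d \<one> k < \<eta> \<longrightarrow> (\<forall>g\<in>carrier G.
        \<bar>f (inv (g \<otimes> k)) - f (inv g)\<bar> < \<epsilon> \<and> \<bar>f (inv (k \<otimes> g)) - f (inv g)\<bar> < \<epsilon>)"
    proof (intro exI[of _ \<eta>] conjI ballI impI)
      fix k g assume "k \<in> carrier G" "d \<one> k < \<eta>" "g \<in> carrier G"
      then show "\<bar>f (inv (g \<otimes> k)) - f (inv g)\<bar> < \<epsilon>" "\<bar>f (inv (k \<otimes> g)) - f (inv g)\<bar> < \<epsilon>"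
        using \<eta>(2)[of "inv g" "inv k"] by (simp_all add: d_one_inv inv_mult_group)
    qed (rule \<eta>(1))
  next
    fix s t :: "nat \<Rightarrow> 'a" and U V :: "nat filter"
    assume st: "range s \<subseteq> carrier G" "range t \<subseteq> carrier G" and UV: "ultrafilter U" "ultrafilter V"
    have "s n \<in> carrier G" "t n \<in> carrier G" for n using st by auto
    then have "inv (inv (s n) \<otimes> t m) = inv (t m) \<otimes> s n" for n m by (simp add: inv_mult_group)
    then show "Lim_exchange U V (\<lambda>n m. f (inv (inv (s n) \<otimes> t m)))"
      using wap_exchange[OF f st(2,1) UV(2,1)] by (simp add: Lim_exchange_def)
  qed
qed

end

section \<open>Matrix coefficients of a reflexive isometric representation\<close>

locale reflexive_representation = metric_group G d
  for G :: "('a, 'b) monoid_scheme" (structure) and d +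
  fixes \<pi> :: "'a \<Rightarrow> 'e::banach \<Rightarrow>\<^sub>L 'e"
  assumes reflexive: "reflexive_space TYPE('e)"
    and hom: "\<pi> \<in> hom G isometry_group"
    and cont: "\<And>v \<epsilon>. \<epsilon> > 0 \<Longrightarrow>
      \<exists>\<eta>>0. \<forall>g\<in>carrier G. d \<one> g < \<eta> \<longrightarrow> norm (blinfun_apply (\<pi> g) v - v) < \<epsilon>"
begin

lemma \<pi>_norm: "g \<in> carrier G \<Longrightarrow> norm (blinfun_apply (\<pi> g) v) = norm v"
  using hom by (auto simp: hom_def isometry_group_def)

lemma \<pi>_mult: "g \<in> carrier G \<Longrightarrow> h \<in> carrier G \<Longrightarrow> \<pi> (g \<otimes> h) = \<pi> g o\<^sub>L \<pi> h"
  using hom by (auto simp: hom_def isometry_group_def)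

lemma \<pi>_one: "\<pi> \<one> = id_blinfun"
  using hom_one[OF hom is_group group_isometry_group] by (simp add: isometry_group_def)

text \<open>Composition with \<open>\<pi> g\<close> does not increase the norm, and a further
  composition with \<open>\<pi> (inv g)\<close> recovers \<open>\<phi>\<close>.\<close>

lemma norm_compose_\<pi>:
  fixes \<phi> :: "'e \<Rightarrow>\<^sub>L real"
  assumes g: "g \<in> carrier G"
  shows "norm (\<phi> o\<^sub>L \<pi> g) = norm \<phi>"
proof -
  have le: "norm (\<phi> o\<^sub>L \<pi> g) \<le> norm \<phi>" if "g \<in> carrier G" for g and \<phi> :: "'e \<Rightarrow>\<^sub>L real"
  proof (rule norm_blinfun_bound)
    show "norm (blinfun_apply (\<phi> o\<^sub>L \<pi> g) v) \<le> norm \<phi> * norm v" for v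
      using norm_blinfun[of \<phi> "blinfun_apply (\<pi> g) v"] \<pi>_norm[OF that, of v] by simp
  qed simp
  have "(\<phi> o\<^sub>L \<pi> g) o\<^sub>L \<pi> (inv g) = \<phi> o\<^sub>L \<pi> (g \<otimes> inv g)"
    using g by (simp only: \<pi>_mult inv_closed blinfun_compose_assoc)
  also have "\<dots> = \<phi>" using g by (simp add: \<pi>_one blinfun_eqI)
  finally show ?thesis using le[OF g, of \<phi>] le[of "inv g" "\<phi> o\<^sub>L \<pi> g"] g by simp
qed

lemma cont_finite:
  assumes "finite I" "\<epsilon> > 0"
  shows "\<exists>\<eta>>0. \<forall>g\<in>carrier G. d \<one> g < \<eta> \<longrightarrow> (\<forall>v\<in>I. norm (blinfun_apply (\<pi> g) v - v) < \<epsilon>)"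
  using assms(1)
proof induction
  case empty
  then show ?case by (auto intro: exI[of _ 1])
next
  case (insert w I)
  then obtain \<eta> where "\<eta> > 0"
    "\<forall>g\<in>carrier G. d \<one> g < \<eta> \<longrightarrow> (\<forall>v\<in>I. norm (blinfun_apply (\<pi> g) v - v) < \<epsilon>)" by blast
  moreover obtain \<eta>' where "\<eta>' > 0"
    "\<forall>g\<in>carrier G. d \<one> g < \<eta>' \<longrightarrow> norm (blinfun_apply (\<pi> g) w - w) < \<epsilon>"
    using cont[OF assms(2)] by blast
  ultimately show ?case by (intro exI[of _ "min \<eta> \<eta>'"]) auto
qed

text \<open>The action on the dual is weakly continuous, since bidual elements are evaluations at
  vectors. As the dual is itself reflexive, weak continuity improves to norm continuity.\<close>

lemma dual_cont:
  fixes \<phi> :: "'e \<Rightarrow>\<^sub>L real"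
  assumes \<epsilon>: "\<epsilon> > 0"
  shows "\<exists>\<eta>>0. \<forall>g\<in>carrier G. d \<one> g < \<eta> \<longrightarrow> norm ((\<phi> o\<^sub>L \<pi> g) - \<phi>) < \<epsilon>"
proof -
  \<comment> \<open>\<open>T\<close> reverses products, but its image is still closed under
    composition.\<close>
  define T where "T g = Blinfun (\<lambda>\<phi> :: 'e \<Rightarrow>\<^sub>L real. \<phi> o\<^sub>L \<pi> g)" for g
  have T: "blinfun_apply (T g) \<phi> = \<phi> o\<^sub>L \<pi> g" for g \<phi>
    unfolding T_def
    by (simp add: bounded_linear_Blinfun_apply bounded_bilinear.bounded_linear_left[OF bounded_bilinear_blinfun_compose])
  have \<epsilon>2: "\<epsilon> / 2 > 0" using \<epsilon> by simp
  have iso: "norm (blinfun_apply S \<phi>) = norm \<phi>" if "S \<in> T ` carrier G" for S \<phi>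
    using that by (auto simp: T norm_compose_\<pi>)
  have comp: "R o\<^sub>L S \<in> T ` carrier G" if RS: "R \<in> T ` carrier G" "S \<in> T ` carrier G" for R S
  proof -
    obtain g h where gh: "R = T g" "S = T h" "g \<in> carrier G" "h \<in> carrier G" using RS by blast
    have "R o\<^sub>L S = T (h \<otimes> g)"
      by (rule blinfun_eqI) (simp add: gh T \<pi>_mult blinfun_compose_assoc)
    then show ?thesis using gh by blast
  qed
  have ne: "T ` carrier G \<noteq> {}" using one_closed by blast
  have "\<exists>(\<Psi> :: (('e \<Rightarrow>\<^sub>L real) \<Rightarrow>\<^sub>L real) set) \<eta>. finite \<Psi> \<and> \<eta> > 0 \<and>
    (\<forall>S\<in>T ` carrier G. (\<forall>\<psi>\<in>\<Psi>. \<bar>blinfun_apply \<psi> (blinfun_apply S \<phi> - \<phi>)\<bar> < \<eta>) \<longrightarrow>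
      norm (blinfun_apply S \<phi> - \<phi>) \<le> \<epsilon> / 2)"
    by (rule isometries_weak_imp_strong[OF reflexive_dual[OF reflexive] ne _ _ \<epsilon>2])
      (simp_all only: iso comp)
  then obtain \<Psi> :: "(('e \<Rightarrow>\<^sub>L real) \<Rightarrow>\<^sub>L real) set" and \<eta> where \<Psi>: "finite \<Psi>" "\<eta> > 0"
    "\<forall>S\<in>T ` carrier G. (\<forall>\<psi>\<in>\<Psi>. \<bar>blinfun_apply \<psi> (blinfun_apply S \<phi> - \<phi>)\<bar> < \<eta>) \<longrightarrow>
      norm (blinfun_apply S \<phi> - \<phi>) \<le> \<epsilon> / 2" by blast
  have "\<exists>x. \<forall>\<phi>. blinfun_apply \<psi> \<phi> = blinfun_apply \<phi> x" for \<psi> :: "('e \<Rightarrow>\<^sub>L real) \<Rightarrow>\<^sub>L real"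
    by (rule reflexive_spaceE[OF reflexive, of \<psi>]) blast
  \<comment> \<open>Vectors representing the bidual test functionals: strong continuity of
    \<open>\<pi>\<close> at finitely many of them makes all tests small.\<close>
  then obtain x :: "(('e \<Rightarrow>\<^sub>L real) \<Rightarrow>\<^sub>L real) \<Rightarrow> 'e" where
    x: "\<And>\<psi> \<phi>. blinfun_apply \<psi> \<phi> = blinfun_apply \<phi> (x \<psi>)"
    using choice[of "\<lambda>\<psi> x. \<forall>\<phi>. blinfun_apply \<psi> \<phi> = blinfun_apply \<phi> x"] by blast
  have pos: "\<eta> / (norm \<phi> + 1) > 0" using \<Psi>(2) by (simp add: add_nonneg_pos)
  obtain \<eta>' where \<eta>': "\<eta>' > 0" "\<And>g v. g \<in> carrier G \<Longrightarrow> d \<one> g < \<eta>' \<Longrightarrow> v \<in> x ` \<Psi> \<Longrightarrow>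
      norm (blinfun_apply (\<pi> g) v - v) < \<eta> / (norm \<phi> + 1)"
    using cont_finite[OF finite_imageI[OF \<Psi>(1), of x] pos] by auto
  have "norm ((\<phi> o\<^sub>L \<pi> g) - \<phi>) < \<epsilon>" if g: "g \<in> carrier G" "d \<one> g < \<eta>'" for g
  proof -
    have "\<bar>blinfun_apply \<psi> ((\<phi> o\<^sub>L \<pi> g) - \<phi>)\<bar> < \<eta>" if "\<psi> \<in> \<Psi>" for \<psi>
    proof -
      let ?w = "blinfun_apply (\<pi> g) (x \<psi>) - x \<psi>"
      have "\<bar>blinfun_apply \<psi> ((\<phi> o\<^sub>L \<pi> g) - \<phi>)\<bar> = \<bar>blinfun_apply \<phi> ?w\<bar>"
        by (simp add: x blinfun.diff_left blinfun.diff_right)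
      also have "\<dots> \<le> norm \<phi> * norm ?w" using norm_blinfun[of \<phi> ?w] by simp
      also have "\<dots> \<le> (norm \<phi> + 1) * norm ?w" by (rule mult_right_mono) auto
      also have "\<dots> < \<eta>"
        using \<eta>'(2)[OF g, of "x \<psi>"] that by (intro add_one_mult_less) simp_all
      finally show ?thesis .
    qed
    then have "norm (blinfun_apply (T g) \<phi> - \<phi>) \<le> \<epsilon> / 2"
      using g by (intro bspec[OF \<Psi>(3), rule_format]) (simp_all add: T)
    then show ?thesis using \<epsilon> by (simp add: T)
  qed
  then show ?thesis using \<eta>'(1) by blast
qed

text \<open>Right translations reduce to continuity of \<open>\<pi>\<close> at \<open>v\<close>,
  left translations to \<open>dual_cont\<close> at \<open>\<phi>\<close>. For the exchange of
  limits, the value at \<open>inv (s n) \<otimes> t m\<close> is a pairing of a bounded family of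
  functionals with a bounded family of vectors.\<close>

lemma wap_coefficient: "wap (\<lambda>g. blinfun_apply \<phi> (blinfun_apply (\<pi> g) v))"
proof (rule wapI)
  fix g assume "g \<in> carrier G"
  then show "\<bar>blinfun_apply \<phi> (blinfun_apply (\<pi> g) v)\<bar> \<le> norm \<phi> * norm v"
    using norm_blinfun[of \<phi> "blinfun_apply (\<pi> g) v"] by (simp add: \<pi>_norm)
next
  fix \<epsilon> :: real assume \<epsilon>: "\<epsilon> > 0"
  \<comment> \<open>The added 1 keeps the quotients meaningful when \<open>\<phi>\<close> or
    \<open>v\<close> is zero.\<close>
  have e1: "\<epsilon> / (norm \<phi> + 1) > 0" and e2: "\<epsilon> / (norm v + 1) > 0"
    using \<epsilon> by (simp_all add: add_nonneg_pos)
  obtain \<eta>1 where 1: "\<eta>1 > 0" "\<And>k. k \<in> carrier G \<Longrightarrow> d \<one> k < \<eta>1 \<Longrightarrow>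
      norm (blinfun_apply (\<pi> k) v - v) < \<epsilon> / (norm \<phi> + 1)"
    using cont[OF e1] by blast
  obtain \<eta>2 where 2: "\<eta>2 > 0" "\<And>k. k \<in> carrier G \<Longrightarrow> d \<one> k < \<eta>2 \<Longrightarrow>
      norm ((\<phi> o\<^sub>L \<pi> k) - \<phi>) < \<epsilon> / (norm v + 1)"
    using dual_cont[OF e2] by blast
  show "\<exists>\<eta>>0. \<forall>k\<in>carrier G. d \<one> k < \<eta> \<longrightarrow> (\<forall>g\<in>carrier G.
      \<bar>blinfun_apply \<phi> (blinfun_apply (\<pi> (g \<otimes> k)) v) - blinfun_apply \<phi> (blinfun_apply (\<pi> g) v)\<bar> < \<epsilon> \<and>
      \<bar>blinfun_apply \<phi> (blinfun_apply (\<pi> (k \<otimes> g)) v) - blinfun_apply \<phi> (blinfun_apply (\<pi> g) v)\<bar> < \<epsilon>)"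
  proof (intro exI[of _ "min \<eta>1 \<eta>2"] conjI ballI impI)
    fix k g assume k: "k \<in> carrier G" "d \<one> k < min \<eta>1 \<eta>2" and g: "g \<in> carrier G"
    let ?w = "blinfun_apply (\<pi> k) v - v" and ?\<psi> = "(\<phi> o\<^sub>L \<pi> k) - \<phi>"
    have "\<bar>blinfun_apply \<phi> (blinfun_apply (\<pi> (g \<otimes> k)) v) - blinfun_apply \<phi> (blinfun_apply (\<pi> g) v)\<bar>
        = \<bar>blinfun_apply \<phi> (blinfun_apply (\<pi> g) ?w)\<bar>"
      using k g by (simp add: \<pi>_mult blinfun.diff_right)
    also have "\<dots> \<le> norm \<phi> * norm ?w"
      using norm_blinfun[of \<phi> "blinfun_apply (\<pi> g) ?w"] g by (simp add: \<pi>_norm)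
    also have "\<dots> \<le> (norm \<phi> + 1) * norm ?w" by (rule mult_right_mono) auto
    also have "\<dots> < \<epsilon>" using 1(2)[of k] k by (intro add_one_mult_less) simp_all
    finally show "\<bar>blinfun_apply \<phi> (blinfun_apply (\<pi> (g \<otimes> k)) v) - blinfun_apply \<phi> (blinfun_apply (\<pi> g) v)\<bar> < \<epsilon>" .
    have "\<bar>blinfun_apply \<phi> (blinfun_apply (\<pi> (k \<otimes> g)) v) - blinfun_apply \<phi> (blinfun_apply (\<pi> g) v)\<bar>
        = \<bar>blinfun_apply ?\<psi> (blinfun_apply (\<pi> g) v)\<bar>"
      using k g by (simp add: \<pi>_mult blinfun.diff_left)
    also have "\<dots> \<le> norm ?\<psi> * norm v"
      using norm_blinfun[of ?\<psi> "blinfun_apply (\<pi> g) v"] g by (simp add: \<pi>_norm)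
    also have "\<dots> \<le> (norm v + 1) * norm ?\<psi>" by (simp add: algebra_simps)
    also have "\<dots> < \<epsilon>" using 2(2)[of k] k by (intro add_one_mult_less) simp_all
    finally show "\<bar>blinfun_apply \<phi> (blinfun_apply (\<pi> (k \<otimes> g)) v) - blinfun_apply \<phi> (blinfun_apply (\<pi> g) v)\<bar> < \<epsilon>" .
  qed (use 1 2 in simp)
next
  fix s t :: "nat \<Rightarrow> 'a" and U V :: "nat filter"
  assume st: "range s \<subseteq> carrier G" "range t \<subseteq> carrier G" and UV: "ultrafilter U" "ultrafilter V"
  have st': "s n \<in> carrier G" "t n \<in> carrier G" for n using st by auto
  have "Lim_exchange U V (\<lambda>n m. blinfun_apply (\<phi> o\<^sub>L \<pi> (inv (s n))) (blinfun_apply (\<pi> (t m)) v))"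
  proof (rule Lim_exchange_pairing[OF reflexive UV])
    show "norm (\<phi> o\<^sub>L \<pi> (inv (s n))) \<le> norm \<phi>" for n by (simp add: norm_compose_\<pi> st')
    show "norm (blinfun_apply (\<pi> (t m)) v) \<le> norm v" for m by (simp add: \<pi>_norm st')
  qed
  moreover have "\<pi> (inv (s n) \<otimes> t m) = \<pi> (inv (s n)) o\<^sub>L \<pi> (t m)" for n m
    by (simp add: \<pi>_mult st')
  ultimately show "Lim_exchange U V (\<lambda>n m. blinfun_apply \<phi> (blinfun_apply (\<pi> (inv (s n) \<otimes> t m)) v))"
    by simp
qed

end

section \<open>Weak neighbourhoods of the identity and bump functions\<close>

context reflexive_representation
begin

lemma weak_imp_strong_finite:
  assumes "finite I" and \<epsilon>: "\<epsilon> > 0"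
  shows "\<exists>(\<Psi> :: (('e \<Rightarrow>\<^sub>L real) \<times> 'e) set) \<eta>. finite \<Psi> \<and> \<eta> > 0 \<and>
    (\<forall>g\<in>carrier G. (\<forall>(\<psi>, v)\<in>\<Psi>. \<bar>blinfun_apply \<psi> (blinfun_apply (\<pi> g) v - v)\<bar> < \<eta>) \<longrightarrow>
      (\<forall>v\<in>I. norm (blinfun_apply (\<pi> g) v - v) < \<epsilon>))"
  using assms(1)
proof induction
  case empty
  show ?case by (intro exI[of _ "{}"] exI[of _ 1]) simp
next
  case (insert w I)
  then obtain \<Psi> :: "(('e \<Rightarrow>\<^sub>L real) \<times> 'e) set" and \<eta> where \<Psi>: "finite \<Psi>" "\<eta> > 0"
    "\<forall>g\<in>carrier G. (\<forall>(\<psi>, v)\<in>\<Psi>. \<bar>blinfun_apply \<psi> (blinfun_apply (\<pi> g) v - v)\<bar> < \<eta>) \<longrightarrow>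
      (\<forall>v\<in>I. norm (blinfun_apply (\<pi> g) v - v) < \<epsilon>)" by blast
  have \<epsilon>2: "\<epsilon> / 2 > 0" using \<epsilon> by simp
  have ne: "\<pi> ` carrier G \<noteq> {}" using one_closed by blast
  have iso: "norm (blinfun_apply S v) = norm v" if "S \<in> \<pi> ` carrier G" for S v
    using that by (auto simp: \<pi>_norm)
  have comp: "R o\<^sub>L S \<in> \<pi> ` carrier G" if "R \<in> \<pi> ` carrier G" "S \<in> \<pi> ` carrier G" for R S
    using that by (auto simp flip: \<pi>_mult)
  have "\<exists>(\<Phi> :: ('e \<Rightarrow>\<^sub>L real) set) \<theta>. finite \<Phi> \<and> \<theta> > 0 \<and>
    (\<forall>S\<in>\<pi> ` carrier G. (\<forall>\<psi>\<in>\<Phi>. \<bar>blinfun_apply \<psi> (blinfun_apply S w - w)\<bar> < \<theta>) \<longrightarrow>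
      norm (blinfun_apply S w - w) \<le> \<epsilon> / 2)"
    by (rule isometries_weak_imp_strong[OF reflexive ne _ _ \<epsilon>2]) (simp_all only: iso comp)
  then obtain \<Phi> :: "('e \<Rightarrow>\<^sub>L real) set" and \<theta> where \<Phi>: "finite \<Phi>" "\<theta> > 0"
    "\<forall>S\<in>\<pi> ` carrier G. (\<forall>\<psi>\<in>\<Phi>. \<bar>blinfun_apply \<psi> (blinfun_apply S w - w)\<bar> < \<theta>) \<longrightarrow>
      norm (blinfun_apply S w - w) \<le> \<epsilon> / 2" by blast
  let ?\<Psi> = "\<Psi> \<union> (\<lambda>\<psi>. (\<psi>, w)) ` \<Phi>"
  show ?case
  proof (intro exI[of _ ?\<Psi>] exI[of _ "min \<eta> \<theta>"] conjI ballI impI)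
    show "finite ?\<Psi>" "min \<eta> \<theta> > 0" using \<Psi> \<Phi> by auto
    fix g v
    assume g: "g \<in> carrier G" and v: "v \<in> insert w I"
      and small: "\<forall>(\<psi>, v)\<in>?\<Psi>. \<bar>blinfun_apply \<psi> (blinfun_apply (\<pi> g) v - v)\<bar> < min \<eta> \<theta>"
    have "\<forall>(\<psi>, v)\<in>\<Psi>. \<bar>blinfun_apply \<psi> (blinfun_apply (\<pi> g) v - v)\<bar> < \<eta>" using small by auto
    then have "\<forall>v\<in>I. norm (blinfun_apply (\<pi> g) v - v) < \<epsilon>" using \<Psi>(3) g by blast
    moreover have "\<forall>\<psi>\<in>\<Phi>. \<bar>blinfun_apply \<psi> (blinfun_apply (\<pi> g) w - w)\<bar> < \<theta>" using small by auto
    then have "norm (blinfun_apply (\<pi> g) w - w) \<le> \<epsilon> / 2" using \<Phi>(3) g by blast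
    ultimately show "norm (blinfun_apply (\<pi> g) v - v) < \<epsilon>" using v \<epsilon> by auto
  qed
qed

text \<open>The hypothesis says that the strong neighbourhood given by \<open>I\<close> and
  \<open>\<epsilon>\<close> pulls back into the \<open>r\<close>-ball. Finitely many coefficients
  detect that neighbourhood, so outside the ball one of them moves by at least
  \<open>\<eta>\<close>; symmetrising and truncating their sum gives the bump.\<close>

lemma wap_bump:
  assumes sep: "finite I" "\<epsilon> > 0"
      "\<And>g. g \<in> carrier G \<Longrightarrow> (\<And>v. v \<in> I \<Longrightarrow> norm (blinfun_apply (\<pi> g) v - v) < \<epsilon>) \<Longrightarrow> d \<one> g < r"
  shows "\<exists>p. wap p \<and> (\<forall>g\<in>carrier G. 0 \<le> p g \<and> p g \<le> 1 \<and> p (inv g) = p g \<and> (r \<le> d \<one> g \<longrightarrow> p g = 1)) \<and>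
    (\<exists>\<rho>>0. \<forall>g\<in>carrier G. d \<one> g < \<rho> \<longrightarrow> p g = 0)"
proof -
  obtain \<Psi> :: "(('e \<Rightarrow>\<^sub>L real) \<times> 'e) set" and \<eta> where \<Psi>: "finite \<Psi>" "\<eta> > 0"
    "\<forall>g\<in>carrier G. (\<forall>(\<psi>, v)\<in>\<Psi>. \<bar>blinfun_apply \<psi> (blinfun_apply (\<pi> g) v - v)\<bar> < \<eta>) \<longrightarrow>
      (\<forall>v\<in>I. norm (blinfun_apply (\<pi> g) v - v) < \<epsilon>)"
    using weak_imp_strong_finite[OF sep(1,2)] by blast
  define c where "c g = (\<Sum>(\<psi>, v)\<in>\<Psi>. \<bar>blinfun_apply \<psi> (blinfun_apply (\<pi> g) v) - blinfun_apply \<psi> v\<bar>)" for g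
  define b where "b g = c g + c (inv g)" for g
  \<comment> \<open>A ramp rising from 0 at \<open>\<eta> / 2\<close> to 1 at
    \<open>\<eta>\<close>.\<close>
  define h :: "real \<Rightarrow> real" where "h x = max 0 (min 1 (2 / \<eta> * x - 1))" for x
  have c_nonneg: "c g \<ge> 0" for g unfolding c_def by (rule sum_nonneg) auto
  have "wap c"
  proof -
    have "wap (\<lambda>g. \<Sum>i\<in>\<Psi>. \<bar>blinfun_apply (fst i) (blinfun_apply (\<pi> g) (snd i)) - blinfun_apply (fst i) (snd i)\<bar>)"
      by (intro wap_sum \<Psi>(1) wap_comp[where h = "\<lambda>x. \<bar>x - c\<bar>" and L = 1 for c] wap_coefficient lipschitz_onI)
        (auto simp: dist_real_def)
    then show ?thesis unfolding c_def[abs_def] case_prod_unfold .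
  qed
  then have "wap b" unfolding b_def by (intro wap_add wap_inv)
  have h_lip: "(2 / \<eta>)-lipschitz_on UNIV h"
  proof (rule lipschitz_onI)
    fix x y :: real
    have "\<bar>h x - h y\<bar> \<le> \<bar>2 / \<eta> * x - 2 / \<eta> * y\<bar>" by (auto simp: h_def max_def min_def)
    also have "\<dots> = \<bar>2 / \<eta>\<bar> * \<bar>x - y\<bar>" unfolding abs_mult[symmetric] right_diff_distrib ..
    also have "\<dots> = 2 / \<eta> * \<bar>x - y\<bar>" using \<Psi>(2) by simp
    finally show "dist (h x) (h y) \<le> 2 / \<eta> * dist x y" by (simp add: dist_real_def)
  qed (use \<Psi>(2) in simp)
  have "wap (\<lambda>g. h (b g))" by (rule wap_comp[OF \<open>wap b\<close> h_lip])
  moreover have "h (b g) = 1" if g: "g \<in> carrier G" "r \<le> d \<one> g" for g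
  proof -
    have "\<not> (\<forall>v\<in>I. norm (blinfun_apply (\<pi> g) v - v) < \<epsilon>)" using sep(3)[OF g(1)] g(2) by fastforce
    then obtain \<psi> v where \<psi>: "(\<psi>, v) \<in> \<Psi>" "\<eta> \<le> \<bar>blinfun_apply \<psi> (blinfun_apply (\<pi> g) v - v)\<bar>"
      using \<Psi>(3) g(1) by force
    note \<psi>(2)
    also have "\<bar>blinfun_apply \<psi> (blinfun_apply (\<pi> g) v - v)\<bar> \<le> c g"
      unfolding c_def using member_le_sum[OF \<psi>(1), of "\<lambda>(\<psi>, v). \<bar>blinfun_apply \<psi> (blinfun_apply (\<pi> g) v) - blinfun_apply \<psi> v\<bar>"] \<Psi>(1)
      by (auto simp: blinfun.diff_right)
    also have "c g \<le> b g" using c_nonneg by (simp add: b_def)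
    finally show ?thesis using \<Psi>(2) by (simp add: h_def field_simps)
  qed
  moreover have "\<exists>\<rho>>0. \<forall>g\<in>carrier G. d \<one> g < \<rho> \<longrightarrow> h (b g) = 0"
  proof -
    \<comment> \<open>Since \<open>b\<close> vanishes at the identity, uniform continuity keeps it
      below \<open>\<eta> / 2\<close> on a ball, where the ramp is 0.\<close>
    have b1: "b \<one> = 0" by (simp add: b_def c_def \<pi>_one case_prod_unfold)
    obtain \<rho> where \<rho>: "\<rho> > 0" "\<And>g k. g \<in> carrier G \<Longrightarrow> k \<in> carrier G \<Longrightarrow> d \<one> k < \<rho> \<Longrightarrow>
        \<bar>b (g \<otimes> k) - b g\<bar> < \<eta> / 2 \<and> \<bar>b (k \<otimes> g) - b g\<bar> < \<eta> / 2"
      using wap_uniform[OF \<open>wap b\<close>, of "\<eta> / 2"] \<Psi>(2) by auto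
    have "h (b g) = 0" if "g \<in> carrier G" "d \<one> g < \<rho>" for g
    proof -
      have "b g < \<eta> / 2" using \<rho>(2)[OF one_closed that] that b1 by simp
      then have "2 / \<eta> * b g \<le> 1" using \<Psi>(2) by (simp add: field_simps)
      then show ?thesis by (simp add: h_def)
    qed
    then show ?thesis using \<rho>(1) by blast
  qed
  moreover have "b (inv g) = b g" if "g \<in> carrier G" for g using that by (simp add: b_def)
  moreover have "0 \<le> h x" "h x \<le> 1" for x by (simp_all add: h_def)
  ultimately show ?thesis by (intro exI[of _ "\<lambda>g. h (b g)"]) simp
qed

end

section \<open>Series with weights \<open>(2/3) ^ n\<close>\<close>

lemma sums_two_thirds: "(\<lambda>n. (2/3) ^ (n + N) :: real) sums (3 * (2/3) ^ N)"
proof -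
  have "(\<lambda>n. (2/3) ^ n :: real) sums 3" using geometric_sums[of "2/3 :: real"] by simp
  then show ?thesis using sums_mult2[of "\<lambda>n. (2/3) ^ n :: real" 3 "(2/3) ^ N"] by (simp add: power_add)
qed

lemma summable_two_thirds_mult:
  fixes P :: "nat \<Rightarrow> real"
  assumes "\<And>n. 0 \<le> P n" "\<And>n. P n \<le> 1"
  shows "summable (\<lambda>n. (2/3) ^ n * P n)"
proof (rule summable_comparison_test')
  show "summable (\<lambda>n. (2/3) ^ n :: real)" using sums_summable[OF sums_two_thirds[of 0]] by simp
  show "norm ((2/3) ^ n * P n) \<le> (2/3) ^ n" if "n \<ge> 0" for n
    using assms[of n] by (simp add: mult_left_le)
qed

lemma suminf_two_thirds_tail:
  fixes P :: "nat \<Rightarrow> real"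
  assumes P: "\<And>n. 0 \<le> P n" "\<And>n. P n \<le> 1"
  shows "0 \<le> (\<Sum>n. (2/3) ^ n * P n) - (\<Sum>n<N. (2/3) ^ n * P n)"
    and "(\<Sum>n. (2/3) ^ n * P n) - (\<Sum>n<N. (2/3) ^ n * P n) \<le> 3 * (2/3) ^ N"
proof -
  have s: "summable (\<lambda>n. (2/3) ^ (n + N) * P (n + N))"
    using summable_two_thirds_mult[OF P] by (rule summable_ignore_initial_segment)
  have eq: "(\<Sum>n. (2/3) ^ n * P n) - (\<Sum>n<N. (2/3) ^ n * P n) = (\<Sum>n. (2/3) ^ (n + N) * P (n + N))"
    by (rule suminf_minus_initial_segment[symmetric, OF summable_two_thirds_mult[OF P]])
  show "0 \<le> (\<Sum>n. (2/3) ^ n * P n) - (\<Sum>n<N. (2/3) ^ n * P n)"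
    unfolding eq by (rule suminf_nonneg[OF s]) (simp add: P)
  have "(\<Sum>n. (2/3) ^ (n + N) * P (n + N)) \<le> (\<Sum>n. (2/3) ^ (n + N))"
    by (rule suminf_le[OF _ s sums_summable[OF sums_two_thirds]]) (simp add: P mult_left_le)
  then show "(\<Sum>n. (2/3) ^ n * P n) - (\<Sum>n<N. (2/3) ^ n * P n) \<le> 3 * (2/3) ^ N"
    unfolding eq sums_unique[OF sums_two_thirds, symmetric] .
qed

text \<open>\<open>P\<close>, \<open>Q\<close> and \<open>R\<close> stand for the values of
  \<open>p n\<close> at the longer factor, the shorter factor and the product. The defect
  \<open>D\<close> is at least 1 from \<open>m\<close> on, at least -1 at \<open>m - 1\<close>, and
  barely negative before. With ratio 1/2 the tail would pay for the term \<open>m - 1\<close> only;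
  the ratio 2/3 doubles this budget.\<close>

lemma weighted_sum_triangle:
  fixes P Q R :: "nat \<Rightarrow> real"
  assumes P: "\<And>n. 0 \<le> P n" "\<And>n. P n \<le> 1" and Q: "\<And>n. 0 \<le> Q n" "\<And>n. Q n \<le> 1"
    and R: "\<And>n. 0 \<le> R n" "\<And>n. R n \<le> 1"
    and one: "\<And>n. m \<le> n \<Longrightarrow> P n = 1" "\<And>n. m \<le> n \<Longrightarrow> Q n = 1"
    and close: "\<And>n. Suc n < m \<Longrightarrow> R n \<le> P n + (2/3) ^ (m - 1) / 3"
  shows "(\<Sum>n. (2/3) ^ n * R n) \<le> (\<Sum>n. (2/3) ^ n * P n) + (\<Sum>n. (2/3) ^ n * Q n)"
proof -
  note sP = summable_two_thirds_mult[OF P] and sQ = summable_two_thirds_mult[OF Q]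
    and sR = summable_two_thirds_mult[OF R]
  define D where "D n = P n + Q n - R n" for n
  have sD: "summable (\<lambda>n. (2/3) ^ n * D n)"
    using summable_diff[OF summable_add[OF sP sQ] sR] by (simp add: D_def algebra_simps)
  have eq: "(\<Sum>n. (2/3) ^ n * D n) =
      (\<Sum>n. (2/3) ^ n * P n) + (\<Sum>n. (2/3) ^ n * Q n) - (\<Sum>n. (2/3) ^ n * R n)"
    using suminf_add[OF sP sQ] suminf_diff[OF summable_add[OF sP sQ] sR]
    by (simp add: D_def algebra_simps)
  have D1: "1 \<le> D n" if "m \<le> n" for n using one[OF that] R(2)[of n] by (simp add: D_def)
  have "0 \<le> (\<Sum>n. (2/3) ^ n * D n)"
  proof (cases m)
    case 0
    have "0 \<le> D n" for n using D1[of n] 0 by simp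
    then show ?thesis by (intro suminf_nonneg sD) simp
  next
    case (Suc l)
    let ?a = "(2/3) ^ l :: real"
    have "- ?a \<le> (\<Sum>n<l. (2/3) ^ n * D n)"
    proof -
      have D2: "- (?a / 3) \<le> D n" if "n < l" for n using close[of n] Q(1)[of n] Suc that by (simp add: D_def)
      \<comment> \<open>The earlier weights sum to at most 3, which the factor 1/3 in the tolerance
        of \<open>close\<close> compensates.\<close>
      have "(\<Sum>n<l. (2/3) ^ n * (1 :: real)) \<le> 3"
        using suminf_two_thirds_tail(1)[of "\<lambda>n. 1" l] sums_unique[OF sums_two_thirds[of 0]] by simp
      then have "- ?a \<le> (\<Sum>n<l. (2/3) ^ n * 1) * (- (?a / 3))"
        using mult_left_mono[of "\<Sum>n<l. (2/3) ^ n * (1 :: real)" 3 "?a / 3"] by (simp add: mult.commute)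
      also have "\<dots> \<le> (\<Sum>n<l. (2/3) ^ n * D n)"
        unfolding sum_distrib_right mult_1_right using D2
        by (intro sum_mono mult_left_mono) simp_all
      finally show ?thesis .
    qed
    moreover have "- ?a \<le> ?a * D l"
      using mult_left_mono[of "-1" "D l" ?a] P(1)[of l] Q(1)[of l] R(2)[of l] by (simp add: D_def)
    moreover have "2 * ?a \<le> (\<Sum>n. (2/3) ^ (n + m) * D (n + m))"
    proof -
      have "2 * ?a = (\<Sum>n. (2/3) ^ (n + m))"
        using sums_unique[OF sums_two_thirds[of m]] Suc by simp
      also have "\<dots> \<le> (\<Sum>n. (2/3) ^ (n + m) * D (n + m))"
        by (intro suminf_le sums_summable[OF sums_two_thirds] summable_ignore_initial_segment[OF sD])
          (use D1 in simp)
      finally show ?thesis .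
    qed
    moreover have "(\<Sum>n. (2/3) ^ n * D n) =
        (\<Sum>n. (2/3) ^ (n + m) * D (n + m)) + ((\<Sum>n<l. (2/3) ^ n * D n) + ?a * D l)"
      using suminf_split_initial_segment[OF sD, of m] Suc by simp
    ultimately show ?thesis by linarith
  qed
  then show ?thesis using eq by simp
qed

section \<open>The stable metric\<close>

text \<open>The conditions for \<open>j < n\<close> record that \<open>r n\<close> is chosen after
  all earlier bumps; \<open>r_le\<close> makes the radii tend to 0, so every nontrivial element lies
  beyond some radius.\<close>

locale wap_scale = metric_group G d
  for G :: "('a, 'b) monoid_scheme" (structure) and d +
  fixes p :: "nat \<Rightarrow> 'a \<Rightarrow> real" and r :: "nat \<Rightarrow> real"
  assumes p_wap: "\<And>n. wap (p n)"
    and p_ge: "\<And>n g. g \<in> carrier G \<Longrightarrow> 0 \<le> p n g"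
    and p_le: "\<And>n g. g \<in> carrier G \<Longrightarrow> p n g \<le> 1"
    and p_inv: "\<And>n g. g \<in> carrier G \<Longrightarrow> p n (inv g) = p n g"
    and p_far: "\<And>n g. g \<in> carrier G \<Longrightarrow> r n \<le> d \<one> g \<Longrightarrow> p n g = 1"
    and r_pos: "\<And>n. 0 < r n"
    and r_le: "\<And>n. r n \<le> (1/2) ^ n"
    and p_near: "\<And>j n k. j < n \<Longrightarrow> k \<in> carrier G \<Longrightarrow> d \<one> k < r n \<Longrightarrow> p j k = 0"
    and p_right: "\<And>j n k g. j < n \<Longrightarrow> k \<in> carrier G \<Longrightarrow> d \<one> k < r n \<Longrightarrow> g \<in> carrier G \<Longrightarrow>
      p j (g \<otimes> k) \<le> p j g + (2/3) ^ n / 3"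
    and p_left: "\<And>j n k g. j < n \<Longrightarrow> k \<in> carrier G \<Longrightarrow> d \<one> k < r n \<Longrightarrow> g \<in> carrier G \<Longrightarrow>
      p j (k \<otimes> g) \<le> p j g + (2/3) ^ n / 3"
begin

definition len :: "'a \<Rightarrow> real" where
  "len g = (\<Sum>n. (2/3) ^ n * p n g)"

lemma len_ge: "g \<in> carrier G \<Longrightarrow> r n \<le> d \<one> g \<Longrightarrow> (2/3) ^ n \<le> len g"
proof -
  assume g: "g \<in> carrier G" "r n \<le> d \<one> g"
  have "(2/3) ^ n = (2/3) ^ n * p n g" using p_far[OF g] by simp
  also have "\<dots> \<le> (\<Sum>i<Suc n. (2/3) ^ i * p i g)"
    using sum_nonneg[of "{..<n}" "\<lambda>i. (2/3) ^ i * p i g"] p_ge[OF g(1)] by simp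
  also have "\<dots> \<le> len g"
    using suminf_two_thirds_tail(1)[of "\<lambda>n. p n g" "Suc n"] p_ge p_le g(1) by (simp add: len_def)
  finally show ?thesis .
qed

text \<open>Inside the \<open>r n\<close>-ball all terms before \<open>n\<close> vanish, which
  leaves a geometric tail.\<close>

lemma len_le: "g \<in> carrier G \<Longrightarrow> d \<one> g < r n \<Longrightarrow> len g \<le> 3 * (2/3) ^ n"
  using suminf_two_thirds_tail(2)[of "\<lambda>n. p n g" n] p_ge p_le p_near[of _ n g] by (simp add: len_def)

lemma len_nonneg: "g \<in> carrier G \<Longrightarrow> 0 \<le> len g"
  using suminf_two_thirds_tail(1)[of "\<lambda>n. p n g" 0] p_ge p_le by (simp add: len_def)

lemma len_inv: "g \<in> carrier G \<Longrightarrow> len (inv g) = len g"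
  by (simp add: len_def p_inv)

lemma len_one: "len \<one> = 0"
proof -
  have "p n \<one> = 0" for n using p_near[of n "Suc n" \<one>] r_pos by simp
  then show ?thesis by (simp add: len_def)
qed

lemma scale_exists:
  assumes "g \<in> carrier G" "g \<noteq> \<one>"
  shows "\<exists>n. r n \<le> d \<one> g"
proof -
  have "d \<one> g > 0" using assms by (simp add: mdist_pos_less)
  then obtain n where "(1/2) ^ n < d \<one> g" using real_arch_pow_inv[of "d \<one> g" "1/2"] by auto
  then show ?thesis using r_le[of n] by (intro exI[of _ n]) linarith
qed

text \<open>The radii are not assumed to decrease. If \<open>g\<close> were in the
  \<open>r n\<close>-ball for some \<open>n > m\<close>, then \<open>p m g\<close> would be 0 by
  \<open>p_near\<close>, whereas \<open>p_far\<close> makes it 1.\<close>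

lemma p_beyond_scale:
  assumes g: "g \<in> carrier G" "r m \<le> d \<one> g" and "m \<le> n"
  shows "p n g = 1"
proof (rule ccontr)
  assume neq: "p n g \<noteq> 1"
  then have "d \<one> g < r n" using p_far[OF g(1), of n] by linarith
  moreover have "m \<noteq> n" using neq p_far[OF g] by auto
  ultimately show False using p_near[of m n g] p_far[OF g] g(1) \<open>m \<le> n\<close> by simp
qed

text \<open>
  With \<open>m\<close> the scale of the shorter factor, the terms of index at least \<open>m\<close> leave the slack
  \<open>(\<Sum>n\<ge>m. (2/3)^n) = 2 * (2/3)^(m - 1)\<close>. Half of it pays for the term \<open>m - 1\<close>, half for
  the earlier terms, which hardly change under translation by the shorter factor.
\<close>

lemma len_mult:
  assumes g: "g \<in> carrier G" and h: "h \<in> carrier G"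
  shows "len (g \<otimes> h) \<le> len g + len h"
proof (cases "g = \<one> \<or> h = \<one>")
  case True
  then show ?thesis using g h by (auto simp: len_one)
next
  case False
  have "\<exists>m. r m \<le> d \<one> x \<and> (\<forall>n<m. d \<one> x < r n)" if x: "x \<in> carrier G" "x \<noteq> \<one>" for x
    using exists_least_iff[of "\<lambda>n. r n \<le> d \<one> x"] scale_exists[OF x] by (simp add: not_le)
  then obtain a b where a: "r a \<le> d \<one> g" "\<forall>n<a. d \<one> g < r n" and b: "r b \<le> d \<one> h" "\<forall>n<b. d \<one> h < r n"
    using False g h by meson
  note bounds = p_ge[OF g] p_le[OF g] p_ge[OF h] p_le[OF h] p_ge[OF m_closed[OF g h]] p_le[OF m_closed[OF g h]]
  show ?thesis
  proof (cases "a \<le> b")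
    case True
    show ?thesis unfolding len_def
    proof (rule weighted_sum_triangle[where m = b])
      \<comment> \<open>The last radius known to exceed the length of \<open>h\<close> is
        \<open>r (b - 1)\<close>, and it controls the indices below \<open>b - 1\<close>. The index
        \<open>b - 1\<close> itself stays uncontrolled, hence \<open>Suc n < b\<close>.\<close>
      show "p n (g \<otimes> h) \<le> p n g + (2/3) ^ (b - 1) / 3" if "Suc n < b" for n
        using that b(2) g h by (intro p_right) auto
    qed (use True p_beyond_scale[OF g a(1)] p_beyond_scale[OF h b(1)] bounds in auto)
  next
    case False
    have "len (g \<otimes> h) \<le> len h + len g" unfolding len_def
    proof (rule weighted_sum_triangle[where m = a])
      show "p n (g \<otimes> h) \<le> p n h + (2/3) ^ (a - 1) / 3" if "Suc n < a" for n
        using that a(2) g h by (intro p_left) auto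
    qed (use False p_beyond_scale[OF g a(1)] p_beyond_scale[OF h b(1)] bounds in auto)
    then show ?thesis by simp
  qed
qed

text \<open>The value 0 off the carrier is there because \<open>Metric_space\<close> demands
  nonnegativity and symmetry for all arguments of the type.\<close>

definition \<delta> :: "'a \<Rightarrow> 'a \<Rightarrow> real" where
  "\<delta> x y = (if x \<in> carrier G \<and> y \<in> carrier G then len (inv x \<otimes> y) else 0)"

lemma Metric_space_\<delta>: "Metric_space (carrier G) \<delta>"
proof
  show "0 \<le> \<delta> x y" for x y by (simp add: \<delta>_def len_nonneg)
  show "\<delta> x y = \<delta> y x" for x y
    using len_inv[of "inv x \<otimes> y"] by (auto simp: \<delta>_def inv_mult_group)
next
  fix x y assume xy: "x \<in> carrier G" "y \<in> carrier G"
  show "\<delta> x y = 0 \<longleftrightarrow> x = y"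
  proof
    assume "\<delta> x y = 0"
    then have 0: "len (inv x \<otimes> y) = 0" using xy by (simp add: \<delta>_def)
    have "inv x \<otimes> y = \<one>"
    proof (rule ccontr)
      assume "inv x \<otimes> y \<noteq> \<one>"
      then obtain n where "r n \<le> d \<one> (inv x \<otimes> y)" using scale_exists[of "inv x \<otimes> y"] xy by auto
      then have "(2/3) ^ n \<le> len (inv x \<otimes> y)" using xy by (intro len_ge) auto
      moreover have "(2/3 :: real) ^ n > 0" by simp
      ultimately show False using 0 by linarith
    qed
    then show "x = y" using xy by (metis inv_closed inv_equality inv_inv)
  qed (use xy in \<open>simp add: \<delta>_def len_one\<close>)
next
  fix x y z assume xyz: "x \<in> carrier G" "y \<in> carrier G" "z \<in> carrier G"
  have "(inv x \<otimes> y) \<otimes> (inv y \<otimes> z) = inv x \<otimes> z"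
    using xyz by (metis inv_closed inv_solve_left m_assoc m_closed)
  then show "\<delta> x z \<le> \<delta> x y + \<delta> y z"
    using len_mult[of "inv x \<otimes> y" "inv y \<otimes> z"] xyz by (simp add: \<delta>_def)
qed

lemma left_invariant_\<delta>: "left_invariant G \<delta>"
  unfolding left_invariant_def
proof (intro ballI)
  fix g x y assume gxy: "g \<in> carrier G" "x \<in> carrier G" "y \<in> carrier G"
  have "inv (g \<otimes> x) \<otimes> (g \<otimes> y) = inv x \<otimes> (inv g \<otimes> (g \<otimes> y))"
    using gxy by (simp add: inv_mult_group m_assoc)
  also have "inv g \<otimes> (g \<otimes> y) = y" using gxy by (simp flip: m_assoc)
  finally show "\<delta> (g \<otimes> x) (g \<otimes> y) = \<delta> x y" using gxy by (simp add: \<delta>_def)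
qed

lemma stable_\<delta>: "stable_metric G \<delta>"
  unfolding stable_metric_def
proof (intro allI impI, elim conjE)
  fix s t :: "nat \<Rightarrow> 'a" and U V :: "nat filter"
  assume st: "range s \<subseteq> carrier G" "range t \<subseteq> carrier G" and UV: "ultrafilter U" "ultrafilter V"
  have st': "s n \<in> carrier G" "t n \<in> carrier G" for n using st by auto
  have cl: "inv (s n) \<otimes> t m \<in> carrier G" for n m using st' by simp
  have len_le_3: "len g \<le> 3" if "g \<in> carrier G" for g
    using suminf_two_thirds_tail(2)[of "\<lambda>n. p n g" 0] p_ge p_le that by (simp add: len_def)
  have "Lim_exchange U V (\<lambda>n m. len (inv (s n) \<otimes> t m))"
  proof (rule Lim_exchange_uniform_limit[OF UV])
    show "\<bar>len (inv (s n) \<otimes> t m)\<bar> \<le> 3" for n m using len_nonneg[OF cl] len_le_3[OF cl] by simp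
    fix e :: real assume "e > 0"
    \<comment> \<open>\<open>N\<close> is chosen so that the tail bound \<open>3 * (2/3) ^ N\<close>
      drops below \<open>e\<close>.\<close>
    then obtain N where N: "(2/3) ^ N < e / 3" using real_arch_pow_inv[of "e / 3" "2/3"] by auto
    define f where "f g = (\<Sum>i<N. (2/3) ^ i * p i g)" for g
    have f: "wap f" unfolding f_def[abs_def] by (intro wap_sum wap_cmult p_wap finite_lessThan)
    obtain B where B: "\<And>g. g \<in> carrier G \<Longrightarrow> \<bar>f g\<bar> \<le> B" using wap_bounded[OF f] by blast
    have "\<bar>len g - f g\<bar> \<le> e" if "g \<in> carrier G" for g
      using suminf_two_thirds_tail[of "\<lambda>n. p n g" N] p_ge p_le that N by (simp add: len_def f_def)
    then show "\<exists>F' C. Lim_exchange U V F' \<and>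
        (\<forall>n m. \<bar>F' n m\<bar> \<le> C \<and> \<bar>len (inv (s n) \<otimes> t m) - F' n m\<bar> \<le> e)"
      using wap_exchange[OF f st UV] B cl
      by (intro exI[of _ "\<lambda>n m. f (inv (s n) \<otimes> t m)"] exI[of _ B]) simp
  qed
  then show "Lim U (\<lambda>n. Lim V (\<lambda>m. \<delta> (s n) (t m))) = Lim V (\<lambda>m. Lim U (\<lambda>n. \<delta> (s n) (t m)))"
    by (simp add: Lim_exchange_def \<delta>_def st')
qed

lemma uniformly_equivalent_\<delta>: "uniformly_equivalent (carrier G) \<delta> d"
  unfolding uniformly_equivalent_def
proof (intro allI impI)
  fix \<epsilon> :: real assume \<epsilon>: "\<epsilon> > 0"
  obtain m where m: "(1/2) ^ m < \<epsilon>" using real_arch_pow_inv[OF \<epsilon>, of "1/2"] by auto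
  obtain n where n: "(2/3) ^ n < \<epsilon> / 3" using real_arch_pow_inv[of "\<epsilon> / 3" "2/3"] \<epsilon> by auto
  show "\<exists>\<eta>>0. \<forall>x\<in>carrier G. \<forall>y\<in>carrier G. (\<delta> x y < \<eta> \<longrightarrow> d x y < \<epsilon>) \<and> (d x y < \<eta> \<longrightarrow> \<delta> x y < \<epsilon>)"
  \<comment> \<open>The first entry makes \<open>d\<close> small whenever \<open>\<delta>\<close>
    is, the second gives the converse.\<close>
  proof (intro exI[of _ "min ((2/3) ^ m) (r n)"] conjI ballI impI)
    fix x y assume xy: "x \<in> carrier G" "y \<in> carrier G"
    then have cl: "inv x \<otimes> y \<in> carrier G" by simp
    show "d x y < \<epsilon>" if "\<delta> x y < min ((2/3) ^ m) (r n)"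
      using len_ge[OF cl, of m] that xy m r_le[of m] by (fastforce simp: \<delta>_def d_one_inv_mult)
    show "\<delta> x y < \<epsilon>" if "d x y < min ((2/3) ^ m) (r n)"
      using len_le[OF cl, of n] that xy n by (simp add: \<delta>_def d_one_inv_mult)
  qed (simp add: r_pos)
qed

end

text \<open>A bump \<open>P q\<close> is fixed in advance for every radius \<open>q\<close>, so the
  recursion only has to choose radii, each small enough for the bumps at all earlier radii.\<close>

theorem (in metric_group) stable_metric_of_bumps:
  assumes bump: "\<And>r. r > 0 \<Longrightarrow> \<exists>p. wap p \<and>
    (\<forall>g\<in>carrier G. 0 \<le> p g \<and> p g \<le> 1 \<and> p (inv g) = p g \<and> (r \<le> d \<one> g \<longrightarrow> p g = 1)) \<and>
    (\<exists>\<rho>>0. \<forall>g\<in>carrier G. d \<one> g < \<rho> \<longrightarrow> p g = 0)"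
  shows "\<exists>\<delta>. Metric_space (carrier G) \<delta> \<and> left_invariant G \<delta> \<and> stable_metric G \<delta> \<and>
    uniformly_equivalent (carrier G) \<delta> d"
proof -
  have "\<forall>r. \<exists>p. r > 0 \<longrightarrow> wap p \<and>
    (\<forall>g\<in>carrier G. 0 \<le> p g \<and> p g \<le> 1 \<and> p (inv g) = p g \<and> (r \<le> d \<one> g \<longrightarrow> p g = 1)) \<and>
    (\<exists>\<rho>>0. \<forall>g\<in>carrier G. d \<one> g < \<rho> \<longrightarrow> p g = 0)"
    using bump by blast
  from choice[OF this] obtain P where P: "\<And>r. r > 0 \<Longrightarrow> wap (P r) \<and>
    (\<forall>g\<in>carrier G. 0 \<le> P r g \<and> P r g \<le> 1 \<and> P r (inv g) = P r g \<and> (r \<le> d \<one> g \<longrightarrow> P r g = 1)) \<and>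
    (\<exists>\<rho>>0. \<forall>g\<in>carrier G. d \<one> g < \<rho> \<longrightarrow> P r g = 0)" by blast
  define C where "C q e x \<longleftrightarrow> (\<forall>k\<in>carrier G. d \<one> k < x \<longrightarrow> P q k = 0 \<and>
      (\<forall>g\<in>carrier G. P q (g \<otimes> k) \<le> P q g + e \<and> P q (k \<otimes> g) \<le> P q g + e))" for q e x :: real
  have C_ex: "\<exists>x>0. C q e x" if q: "q > 0" and e: "e > 0" for q e
  proof -
    obtain \<rho> where \<rho>: "\<rho> > 0" "\<And>g. g \<in> carrier G \<Longrightarrow> d \<one> g < \<rho> \<Longrightarrow> P q g = 0" using P[OF q] by blast
    obtain \<eta> where \<eta>: "\<eta> > 0" "\<And>g k. g \<in> carrier G \<Longrightarrow> k \<in> carrier G \<Longrightarrow> d \<one> k < \<eta> \<Longrightarrow>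
        \<bar>P q (g \<otimes> k) - P q g\<bar> < e \<and> \<bar>P q (k \<otimes> g) - P q g\<bar> < e"
      using wap_uniform[of "P q" e] P[OF q] e by blast
    have "C q e (min \<rho> \<eta>)" unfolding C_def
    proof (intro ballI impI conjI)
      fix k assume k: "k \<in> carrier G" "d \<one> k < min \<rho> \<eta>"
      then show "P q k = 0" using \<rho>(2) by simp
      fix g assume "g \<in> carrier G"
      then have "\<bar>P q (g \<otimes> k) - P q g\<bar> < e" "\<bar>P q (k \<otimes> g) - P q g\<bar> < e" using \<eta>(2)[of g k] k by auto
      then show "P q (g \<otimes> k) \<le> P q g + e" "P q (k \<otimes> g) \<le> P q g + e" by linarith+
    qed
    then show ?thesis using \<rho>(1) \<eta>(1) by (intro exI[of _ "min \<rho> \<eta>"]) simp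
  qed
  have C_mono: "C q e x" if "C q e y" "x \<le> y" for q e x y using that by (auto simp: C_def)
  define Q :: "(nat \<Rightarrow> real) \<Rightarrow> nat \<Rightarrow> real \<Rightarrow> bool" where
    "Q f n x \<longleftrightarrow> 0 < x \<and> x \<le> (1/2) ^ n \<and> (\<forall>j<n. C (f j) ((2/3) ^ n / 3) x)" for f n x
  \<comment> \<open>\<open>Q f n\<close> consults \<open>f\<close> only below \<open>n\<close>, so
    the radii can be chosen by course-of-values recursion.\<close>
  have "\<exists>r. \<forall>n. Q r n (r n)"
  proof (rule dependent_wellorder_choice)
    show "Q f n x = Q g n x" if "\<And>j. j < n \<Longrightarrow> f j = g j" for f g n x using that by (simp add: Q_def)
    fix n f assume prev: "\<And>j. j < n \<Longrightarrow> Q f j (f j)"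
    have "\<forall>j. \<exists>x. j < n \<longrightarrow> x > 0 \<and> C (f j) ((2/3) ^ n / 3) x"
      using C_ex[of "f _" "(2/3) ^ n / 3"] prev by (fastforce simp: Q_def)
    from choice[OF this] obtain x where x: "\<And>j. j < n \<Longrightarrow> x j > 0 \<and> C (f j) ((2/3) ^ n / 3) (x j)" by blast
    \<comment> \<open>The entry \<open>(1/2) ^ n\<close> gives the required decay and keeps the set
      nonempty for \<open>n = 0\<close>.\<close>
    let ?y = "Min (insert ((1/2) ^ n) (x ` {..<n}))"
    have "?y > 0" using x by (subst Min_gr_iff) auto
    moreover have "?y \<le> (1/2) ^ n" by (rule Min_le) auto
    moreover have "?y \<le> x j" if "j < n" for j using that by (intro Min_le) auto
    then have "C (f j) ((2/3) ^ n / 3) ?y" if "j < n" for j using x[OF that] that by (blast intro: C_mono)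
    ultimately show "\<exists>y. Q f n y" unfolding Q_def by blast
  qed
  then obtain r where r: "\<And>n. Q r n (r n)" by blast
  have pos: "r n > 0" and le: "r n \<le> (1/2) ^ n" for n using r[of n] by (auto simp: Q_def)
  have C: "C (r j) ((2/3) ^ n / 3) (r n)" if "j < n" for j n using r[of n] that by (simp add: Q_def)
  interpret wap_scale G d "\<lambda>n. P (r n)" r
    by unfold_locales (use P[OF pos] pos le C in \<open>auto simp: C_def\<close>)
  show ?thesis
    using Metric_space_\<delta> left_invariant_\<delta> stable_\<delta> uniformly_equivalent_\<delta> by blast
qed

section \<open>Reflexively representable groups\<close>

theorem theorem3p3:
  fixes G :: "('a, 'b) monoid_scheme"
    and X :: "'a topology"
    and d :: "'a \<Rightarrow> 'a \<Rightarrow> real"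
  assumes "topological_group G X"
    and "Metric_space (carrier G) d"
    and "Metric_space.mtopology (carrier G) d = X"
    and "left_invariant G d"
    and "reflexively_representable_on TYPE('e::banach) G X"
  shows "\<exists>\<delta>. Metric_space (carrier G) \<delta> \<and> left_invariant G \<delta> \<and>
             stable_metric G \<delta> \<and> uniformly_equivalent (carrier G) \<delta> d"
proof -
  interpret group G using assms(1) by (simp add: topological_group_def)
  interpret Metric_space "carrier G" d by (rule assms(2))
  interpret metric_group G d by unfold_locales (rule assms(4))
  obtain \<pi> :: "'a \<Rightarrow> 'e \<Rightarrow>\<^sub>L 'e" where refl: "reflexive_space TYPE('e)"
    and hom: "\<pi> \<in> hom G isometry_group"
    and homeo: "homeomorphic_map mtopology (subtopology strong_operator_topology (\<pi> ` carrier G)) \<pi>"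
    using assms(3,5) unfolding reflexively_representable_on_def by blast
  have id: "\<pi> \<one>\<^bsub>G\<^esub> = id_blinfun"
    using hom_one[OF hom is_group group_isometry_group] by (simp add: isometry_group_def)
  have cont: "continuous_map mtopology strong_operator_topology \<pi>"
    using homeomorphic_imp_continuous_map[OF homeo] by (simp add: continuous_map_in_subtopology)
  \<comment> \<open>Continuity into the strong operator topology is continuity of every orbit map,
    tested here at the identity.\<close>
  interpret reflexive_representation G d \<pi>
  proof
    fix v :: 'e and \<epsilon> :: real assume "\<epsilon> > 0"
    have "continuous_map mtopology euclidean (\<lambda>g. blinfun_apply (\<pi> g) v)"
      using cont unfolding continuous_on_strong_operator_topo_iff_coordinatewise by blast
    then have "openin mtopology {g \<in> carrier G. blinfun_apply (\<pi> g) v \<in> ball v \<epsilon>}"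
      using openin_continuous_map_preimage[of mtopology euclidean _ "ball v \<epsilon>"] by fastforce
    moreover have "\<one>\<^bsub>G\<^esub> \<in> {g \<in> carrier G. blinfun_apply (\<pi> g) v \<in> ball v \<epsilon>}"
      using \<open>\<epsilon> > 0\<close> by (simp add: id)
    ultimately obtain \<eta> where "\<eta> > 0" "mball \<one>\<^bsub>G\<^esub> \<eta> \<subseteq> {g \<in> carrier G. blinfun_apply (\<pi> g) v \<in> ball v \<epsilon>}"
      unfolding openin_mtopology by blast
    then show "\<exists>\<eta>>0. \<forall>g\<in>carrier G. d \<one>\<^bsub>G\<^esub> g < \<eta> \<longrightarrow> norm (blinfun_apply (\<pi> g) v - v) < \<epsilon>"
      by (intro exI[of _ \<eta>]) (auto simp: subset_iff dist_norm norm_minus_commute)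
  qed (rule refl hom)+
  show ?thesis
  proof (rule stable_metric_of_bumps)
    fix r :: real assume r: "r > 0"
    \<comment> \<open>Openness of \<open>\<pi>\<close> onto its image makes the image of the
      \<open>r\<close>-ball the trace of a strongly open set.\<close>
    have "openin (subtopology strong_operator_topology (\<pi> ` carrier G)) (\<pi> ` mball \<one>\<^bsub>G\<^esub> r)"
      using homeomorphic_imp_open_map[OF homeo] openin_mball unfolding open_map_def by blast
    then obtain W where W: "open W" "\<pi> ` mball \<one>\<^bsub>G\<^esub> r = blinfun_apply -` W \<inter> \<pi> ` carrier G"
      unfolding openin_subtopology strong_operator_topology_def openin_pullback_topology by auto
    have "\<one>\<^bsub>G\<^esub> \<in> mball \<one>\<^bsub>G\<^esub> r" using r by simp
    then have "blinfun_apply (\<pi> \<one>\<^bsub>G\<^esub>) \<in> W" using W(2) by blast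
    then have "(\<lambda>v. v) \<in> W" by (simp add: id)
    \<comment> \<open>The strong operator topology is pulled back from the product topology on
      functions, so \<open>W\<close> contains a box around the identity with finitely many
      restricted coordinates. These become the set \<open>I\<close> of
      \<open>wap_bump\<close>.\<close>
    then obtain Y where Y: "\<And>v. v \<in> Y v" "\<And>v. open (Y v)" "finite {v. Y v \<noteq> UNIV}" "Pi\<^sub>E UNIV Y \<subseteq> W"
      using product_topology_open_contains_basis[of "\<lambda>v. euclidean" UNIV W "\<lambda>v. v"] W(1)
      unfolding open_fun_def by (auto simp: PiE_iff)
    have "\<forall>v. \<exists>e>0. ball v e \<subseteq> Y v" using Y(1,2) by (simp add: open_contains_ball)
    then obtain e where e: "\<And>v. e v > 0" "\<And>v. ball v (e v) \<subseteq> Y v" by metis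
    let ?I = "{v. Y v \<noteq> UNIV}" and ?\<epsilon> = "Min (insert 1 (e ` {v. Y v \<noteq> UNIV}))"
    show "\<exists>p. wap p \<and>
      (\<forall>g\<in>carrier G. 0 \<le> p g \<and> p g \<le> 1 \<and> p (inv\<^bsub>G\<^esub> g) = p g \<and> (r \<le> d \<one>\<^bsub>G\<^esub> g \<longrightarrow> p g = 1)) \<and>
      (\<exists>\<rho>>0. \<forall>g\<in>carrier G. d \<one>\<^bsub>G\<^esub> g < \<rho> \<longrightarrow> p g = 0)"
    proof (rule wap_bump[OF Y(3)])
      show "?\<epsilon> > 0" using Y(3) e(1) by (subst Min_gr_iff) auto
      fix g assume g: "g \<in> carrier G"
        and near: "\<And>v. v \<in> ?I \<Longrightarrow> norm (blinfun_apply (\<pi> g) v - v) < ?\<epsilon>"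
      have "blinfun_apply (\<pi> g) v \<in> Y v" for v
      proof (cases "v \<in> ?I")
        case True
        have "?\<epsilon> \<le> e v" using Y(3) True by (intro Min_le) auto
        then have "blinfun_apply (\<pi> g) v \<in> ball v (e v)"
          using near[OF True] by (simp add: dist_norm norm_minus_commute)
        then show ?thesis using e(2) by blast
      qed simp
      then have "blinfun_apply (\<pi> g) \<in> W" using Y(4) by (auto simp: PiE_iff)
      then have "\<pi> g \<in> \<pi> ` mball \<one>\<^bsub>G\<^esub> r" using W(2) g by blast
      \<comment> \<open>Membership in \<open>W\<close> only gives \<open>\<pi> g = \<pi> h\<close>
        for some \<open>h\<close> in the ball; injectivity then identifies \<open>g\<close> with
        \<open>h\<close>.\<close>
      then obtain h where "h \<in> mball \<one>\<^bsub>G\<^esub> r" "\<pi> g = \<pi> h" by blast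
      moreover have "inj_on \<pi> (carrier G)"
        using homeomorphic_imp_injective_map[OF homeo] by simp
      ultimately show "d \<one>\<^bsub>G\<^esub> g < r" using g by (auto dest: inj_onD)
    qed
  qed
qed

end
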